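(* Let $h$ be an inverse S-shaped (ISS) distortion function with an inflection point $p\in(0,1)$, and let $C$ be a copula. Consider the statements: (i) $C=C^\pm_p$ and $h'(p^+)\ge h'(0^+)$; (ii) $C$ is universally optimal for $h$. Then (i) implies (ii). If $h$ is strictly ISS (with inflection point $p$), then (i) and (ii) are equivalent.
   Context: Fix an atomless probability space $(\Omega,\mathcal A,\mathbb P)$ and let $\mathcal X$ be the set of bounded random variables on it. $X\overset{\mathrm d}{=}X'$ means equality in law. A distortion function is an increasing (non-strictly) function $h:[0,1]\to[0,1]$ with $h(0)=0$ and $h(1)=1$. The associated distorted expectation $\mathcal E^h:\mathcal X\to\mathbb R$ is $$\mathcal E^h[X]=\int_0^\infty h(\mathbb P(X>x))\,\mathrm dx+\int_{-\infty}^0\big(h(\mathbb P(X>x))-1\big)\,\mathrm dx.$$ A distortion function $h$ is inverse S-shaped (ISS) with inflection point $p\in(0,1)$ if it is continuous, concave on $(0,p)$ and convex on $(p,1)$; it is strictly ISS if it is moreover strictly concave on $(0,p)$ and strictly convex on $(p,1)$. $h'(t^+)$ denotes the right derivative of $h$ at $t\in[0,1)$ (it exists for ISS $h$, possibly infinite). A copula is a distribution function on $[0,1]^2$ with uniform $[0,1]$ marginals. $C$ is a copula of $(X,Y)$ if $\mathbb P(X\le x,Y\le y)=C(\mathbb P(X\le x),\mathbb P(Y\le y))$ for all $x,y\in\mathbb R$. For $p\in(0,1)$, the copula $C^\pm_p$ is given, for $u,v\in[0,1]$, by $C^\pm_p(u,v)=\min\{u,v\}$ if $\min\{u,v\}\in[0,1-p]$,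 and $C^\pm_p(u,v)=\max\{u+v-1,1-p\}$ otherwise. A copula $C$ is universally optimal for $h$ (with linear cost $c(x,y)=x+y$) if for all $X,Y\in\mathcal X$ such that $C$ is a copula of $(X,Y)$, $\mathcal E^h[X+Y]\le\mathcal E^h[X'+Y']$ for all $X',Y'\in\mathcal X$ with $X'\overset{\mathrm d}{=}X$ and $Y'\overset{\mathrm d}{=}Y$. *)

theory Defs
  imports "HOL-Probability.Probability"
begin

definition atomless :: "'a measure \<Rightarrow> bool" where
  "atomless M \<longleftrightarrow>
     (\<forall>A\<in>sets M. measure M A > 0 \<longrightarrow>
        (\<exists>B\<in>sets M. B \<subseteq> A \<and> 0 < measure M B \<and> measure M B < measure M A))"

definition bounded_rvs :: "'a measure \<Rightarrow> ('a \<Rightarrow> real) set" where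
  "bounded_rvs M = {X \<in> borel_measurable M. bounded (X ` space M)}"

definition eq_in_law :: "'a measure \<Rightarrow> ('a \<Rightarrow> real) \<Rightarrow> ('a \<Rightarrow> real) \<Rightarrow> bool" where
  "eq_in_law M X Y \<longleftrightarrow> distr M borel X = distr M borel Y"

text \<open>Functions on the unit interval (and on the unit square) are total functions on the reals
  whose values elsewhere play no role.\<close>

definition distortion :: "(real \<Rightarrow> real) \<Rightarrow> bool" where
  "distortion h \<longleftrightarrow> h ` {0..1} \<subseteq> {0..1} \<and> mono_on {0..1} h \<and> h 0 = 0 \<and> h 1 = 1"

definition distorted_expectation :: "'a measure \<Rightarrow> (real \<Rightarrow> real) \<Rightarrow> ('a \<Rightarrow> real) \<Rightarrow> real" where
  "distorted_expectation M h X =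
     (LBINT x:{0..}. h (\<P>(\<omega> in M. X \<omega> > x)))
     + (LBINT x:{..0}. h (\<P>(\<omega> in M. X \<omega> > x)) - 1)"

definition strictly_convex_on :: "real set \<Rightarrow> (real \<Rightarrow> real) \<Rightarrow> bool" where
  "strictly_convex_on S f \<longleftrightarrow> convex S \<and>
     (\<forall>x\<in>S. \<forall>y\<in>S. \<forall>t. x \<noteq> y \<and> 0 < t \<and> t < 1 \<longrightarrow>
        f ((1 - t) * x + t * y) < (1 - t) * f x + t * f y)"

definition strictly_concave_on :: "real set \<Rightarrow> (real \<Rightarrow> real) \<Rightarrow> bool" where
  "strictly_concave_on S f \<longleftrightarrow> strictly_convex_on S (\<lambda>x. - f x)"

definition ISS :: "(real \<Rightarrow> real) \<Rightarrow> real \<Rightarrow> bool" where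
  "ISS h p \<longleftrightarrow> distortion h \<and> 0 < p \<and> p < 1 \<and> continuous_on {0..1} h \<and>
     concave_on {0<..<p} h \<and> convex_on {p<..<1} h"

definition strictly_ISS :: "(real \<Rightarrow> real) \<Rightarrow> real \<Rightarrow> bool" where
  "strictly_ISS h p \<longleftrightarrow> ISS h p \<and>
     strictly_concave_on {0<..<p} h \<and> strictly_convex_on {p<..<1} h"

text \<open>The limit is taken in the extended reals, since an ISS function may have infinite slope
  at 0.\<close>

definition right_deriv :: "(real \<Rightarrow> real) \<Rightarrow> real \<Rightarrow> ereal" where
  "right_deriv h t = Lim (at_right t) (\<lambda>s. ereal ((h s - h t) / (s - t)))"

definition copula :: "(real \<Rightarrow> real \<Rightarrow> real) \<Rightarrow> bool" where
  "copula C \<longleftrightarrow>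
     (\<exists>N :: (real \<times> real) measure. prob_space N \<and> sets N = sets borel \<and>
        distr N borel fst = uniform_measure lborel {0..1} \<and>
        distr N borel snd = uniform_measure lborel {0..1} \<and>
        (\<forall>u\<in>{0..1}. \<forall>v\<in>{0..1}. C u v = measure N ({..u} \<times> {..v})))"

definition copula_of ::
    "'a measure \<Rightarrow> (real \<Rightarrow> real \<Rightarrow> real) \<Rightarrow> ('a \<Rightarrow> real) \<Rightarrow> ('a \<Rightarrow> real) \<Rightarrow> bool" where
  "copula_of M C X Y \<longleftrightarrow>
     (\<forall>x y. \<P>(\<omega> in M. X \<omega> \<le> x \<and> Y \<omega> \<le> y) = C (\<P>(\<omega> in M. X \<omega> \<le> x)) (\<P>(\<omega> in M. Y \<omega> \<le> y)))"

definition C_pm :: "real \<Rightarrow> real \<Rightarrow> real \<Rightarrow> real" where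
  "C_pm p u v = (if min u v \<in> {0..1 - p} then min u v else max (u + v - 1) (1 - p))"

definition universally_optimal ::
    "'a measure \<Rightarrow> (real \<Rightarrow> real) \<Rightarrow> (real \<Rightarrow> real \<Rightarrow> real) \<Rightarrow> bool" where
  "universally_optimal M h C \<longleftrightarrow>
     (\<forall>X\<in>bounded_rvs M. \<forall>Y\<in>bounded_rvs M. copula_of M C X Y \<longrightarrow>
        (\<forall>X'\<in>bounded_rvs M. \<forall>Y'\<in>bounded_rvs M. eq_in_law M X' X \<longrightarrow> eq_in_law M Y' Y \<longrightarrow>
           distorted_expectation M h (\<lambda>\<omega>. X \<omega> + Y \<omega>)
             \<le> distorted_expectation M h (\<lambda>\<omega>. X' \<omega> + Y' \<omega>)))"

end

theory Submission
  imports Defs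
begin

text \<open>
  Write \<open>q = 1 - p\<close>, \<open>k t = 1 - h (1 - t)\<close> and \<open>F\<close> for the distribution function of \<open>Z = X + Y\<close>. Up to
  a constant, the distorted expectation of \<open>Z\<close> is minus the integral of \<open>k \<circ> F\<close>, and
  \<open>h'(p+) \<ge> h'(0+)\<close> says that some line of slope \<open>c\<close> separates the slopes of \<open>k\<close> on \<open>[0, q]\<close>, where
  \<open>k\<close> is concave, from those on \<open>[q, 1]\<close>, where it is convex. So \<open>k\<close> is a mixture of the functions
  \<open>min t w\<close> for \<open>w \<le> q\<close> and \<open>min t q - min t w\<close> for \<open>w \<ge> q\<close>, plus \<open>c t\<close>, whose integral depends only
  on the mean. For \<open>w \<le> q\<close> the integral of \<open>min F w\<close> is subadditive in \<open>(X, Y)\<close> with equality for the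
  comonotone lower part of \<open>C_pm\<close>. For \<open>w \<ge> q\<close> the difference of the integrals is bounded below through
  \<open>E (d - X - Y)\<^sup>+ = \<integral> P (X \<le> x, Y \<le> d - x) dx\<close> and the Frechet lower bound on the upper part of \<open>Z\<close>,
  with equality for the countermonotone upper part of \<open>C_pm\<close>.

  Conversely, indicators \<open>X\<close> and \<open>Y\<close> force \<open>C u v\<close> to minimise the map from \<open>w\<close> to
  \<open>h (1 - w) + h (1 - u - v + w)\<close>; under strictness and the slope condition the minimiser is unique. The
  slope condition itself follows from one further test with a three-valued \<open>X\<close>.
\<close>

section \<open>Convexity and one-sided derivatives\<close>

text \<open>The map \<open>\<phi> e\<close> pulls every point towards the midpoint and is affine, so
  it commutes with convex combinations. For \<open>0 < e < 1\<close> it lands inside the open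
  interval; continuity carries the inequality to the limit \<open>e = 0\<close>.\<close>

lemma convex_on_closed_interval:
  fixes f :: "real \<Rightarrow> real"
  assumes cv: "convex_on {a<..<b} f" and ct: "continuous_on {a..b} f" and "a < b"
  shows "convex_on {a..b} f"
proof (rule convex_onI)
  fix t x y :: real
  assume t: "0 < t" "t < 1" and x: "x \<in> {a..b}" and y: "y \<in> {a..b}"
  define \<phi> where "\<phi> e z = (1 - e) * z + e * ((a + b) / 2)" for e z :: real
  have inner: "\<phi> e z \<in> {a<..<b}" if "z \<in> {a..b}" "0 < e" "e < 1" for e z
  proof -
    have "(1 - e) * a \<le> (1 - e) * z" "(1 - e) * z \<le> (1 - e) * b"
      using that by (auto intro!: mult_left_mono)
    moreover have "e * a < e * ((a + b) / 2)" "e * ((a + b) / 2) < e * b"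
      using that \<open>a < b\<close> by auto
    moreover have "(1 - e) * a + e * a = a" "(1 - e) * b + e * b = b"
      by (auto simp: algebra_simps)
    ultimately show ?thesis unfolding \<phi>_def greaterThanLessThan_iff by linarith
  qed
  have lim: "((\<lambda>e. f (\<phi> e z)) \<longlongrightarrow> f z) (at_right 0)" if z: "z \<in> {a..b}" for z
  proof -
    have "((\<lambda>e. \<phi> e z) \<longlongrightarrow> \<phi> 0 z) (at_right 0)"
      unfolding \<phi>_def by (intro tendsto_intros)
    then have "((\<lambda>e. \<phi> e z) \<longlongrightarrow> z) (at_right 0)" by (simp add: \<phi>_def)
    moreover have "\<forall>\<^sub>F e in at_right 0. \<phi> e z \<in> {a..b}"
      unfolding eventually_at_right_field using inner[OF z]
      by (intro exI[of _ 1]) force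
    moreover have "continuous (at z within {a..b}) f"
      using ct z by (simp add: continuous_on_eq_continuous_within)
    ultimately show ?thesis
      using ct z continuous_on_tendsto_compose by blast
  qed
  have mem: "(1 - t) * x + t * y \<in> {a..b}"
    using convexD_alt[of "{a..b}" x y t] t x y by auto
  have "\<forall>\<^sub>F e in at_right 0. f (\<phi> e ((1 - t) * x + t * y)) \<le> (1 - t) * f (\<phi> e x) + t * f (\<phi> e y)"
    unfolding eventually_at_right_field
  proof (intro exI[of _ 1] conjI allI impI)
    fix e :: real assume e: "0 < e" "e < 1"
    have "\<phi> e ((1 - t) * x + t * y) = (1 - t) *\<^sub>R \<phi> e x + t *\<^sub>R \<phi> e y"
      unfolding \<phi>_def by (simp add: field_simps)
    then show "f (\<phi> e ((1 - t) * x + t * y)) \<le> (1 - t) * f (\<phi> e x) + t * f (\<phi> e y)"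
      using convex_onD[OF cv, of t "\<phi> e x" "\<phi> e y"] inner[OF x e] inner[OF y e] t by simp
  qed simp
  moreover have "((\<lambda>e. (1 - t) * f (\<phi> e x) + t * f (\<phi> e y)) \<longlongrightarrow> (1 - t) * f x + t * f y) (at_right 0)"
    using lim[OF x] lim[OF y] by (intro tendsto_add tendsto_mult tendsto_const)
  ultimately have "f ((1 - t) * x + t * y) \<le> (1 - t) * f x + t * f y"
    using lim[OF mem] by (intro tendsto_le[of "at_right 0"]) auto
  then show "f ((1 - t) *\<^sub>R x + t *\<^sub>R y) \<le> (1 - t) * f x + t * f y"
    by simp
qed simp

text \<open>\<open>y\<close> and \<open>z\<close> are mirror-image convex combinations of
  \<open>x\<close> and \<open>t\<close>, so the weights cancel in the sum of the two chord bounds.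
  This form compares a function at two pairs of arguments with equal sum.\<close>

lemma convex_on_four_points:
  fixes f :: "real \<Rightarrow> real"
  assumes "convex_on S f" "x \<in> S" "t \<in> S" "x \<le> y" "y \<le> t" "y + z = x + t"
  shows "f y + f z \<le> f x + f t"
proof (cases "x = t")
  case True
  then show ?thesis using assms by (auto intro: order_antisym)
next
  case False
  then have xt: "x < t" using assms by auto
  define l where "l = (y - x) / (t - x)"
  have l: "0 \<le> l" "l \<le> 1" using assms xt by (auto simp: l_def field_simps)
  have lm: "l * (t - x) = y - x" using xt by (simp add: l_def)
  have y: "y = (1 - l) * x + l * t" using lm by (simp add: algebra_simps)
  have z: "z = (1 - l) * t + l * x" using lm assms(6) by (simp add: algebra_simps)
  have "f y \<le> (1 - l) * f x + l * f t" "f z \<le> (1 - l) * f t + l * f x"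
    using convex_onD[OF assms(1) l, of x t] convex_onD[OF assms(1) l, of t x] assms y z by auto
  then show ?thesis by (simp add: algebra_simps)
qed

text \<open>Strictness is given on the open interval only. The outer points are first moved inwards
  by \<open>e\<close>, where the strict inequality holds; the non-strict one on the closed interval
  moves them back.\<close>

lemma strictly_convex_on_four_points:
  fixes f :: "real \<Rightarrow> real"
  assumes sc: "strictly_convex_on {a<..<b} f" and ct: "continuous_on {a..b} f"
    and "a \<le> x" "x < y" "y < t" "t \<le> b" and yz: "y + z = x + t"
  shows "f y + f z < f x + f t"
proof -
  have "convex_on {a<..<b} f"
  proof (rule convex_onI)
    fix u v w :: real assume "0 < u" "u < 1" "v \<in> {a<..<b}" "w \<in> {a<..<b}"
    then show "f ((1 - u) *\<^sub>R v + u *\<^sub>R w) \<le> (1 - u) * f v + u * f w"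
      using sc unfolding strictly_convex_on_def real_scaleR_def
      by (cases "v = w") (simp add: left_diff_distrib, meson less_imp_le)
  qed simp
  then have cv: "convex_on {a..b} f"
    using convex_on_closed_interval ct assms by fastforce
  define e where "e = min (y - x) (z - x) / 2"
  have e: "0 < e" "x + e < y" "y < t - e" "x + e < z" "z < t - e"
    using assms by (auto simp: e_def min_def field_simps)
  define x' where "x' = x + e"
  define t' where "t' = t - e"
  have xt: "x' < t'" "x' \<in> {a<..<b}" "t' \<in> {a<..<b}" using e assms by (auto simp: x'_def t'_def)
  define l where "l = (y - x') / (t' - x')"
  have l: "0 < l" "l < 1" using e xt by (auto simp: l_def x'_def t'_def field_simps)
  have lm: "l * (t' - x') = y - x'" using xt by (simp add: l_def)
  have y: "y = (1 - l) * x' + l * t'" using lm by (simp add: algebra_simps)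
  have z: "z = (1 - l) * t' + l * x'" using lm yz by (simp add: algebra_simps x'_def t'_def)
  have "f y < (1 - l) * f x' + l * f t'" "f z < (1 - l) * f t' + l * f x'"
    using sc xt l unfolding strictly_convex_on_def y z by auto
  then have "f y + f z < f x' + f t'" by (simp add: algebra_simps)
  also have "\<dots> \<le> f x + f t"
    by (rule convex_on_four_points[OF cv]) (use assms e in \<open>auto simp: x'_def t'_def\<close>)
  finally show ?thesis .
qed

text \<open>Completeness of the extended reals provides the limit even when \<open>f\<close> is
  unbounded near \<open>a\<close>, as the difference quotient of \<open>h\<close> at 0 may
  be.\<close>

lemma Lim_at_right_antimono:
  fixes f :: "real \<Rightarrow> ereal"
  assumes "a < b" and anti: "\<And>s t. a < s \<Longrightarrow> s \<le> t \<Longrightarrow> t \<le> b \<Longrightarrow> f t \<le> f s"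
  shows "Lim (at_right a) f = (SUP s\<in>{a<..b}. f s)"
proof (rule tendsto_Lim)
  show "(f \<longlongrightarrow> (SUP s\<in>{a<..b}. f s)) (at_right a)"
  proof (rule order_tendstoI)
    fix y assume "y < (SUP s\<in>{a<..b}. f s)"
    then obtain s where s: "s \<in> {a<..b}" "y < f s" by (auto simp: less_SUP_iff)
    then show "\<forall>\<^sub>F x in at_right a. y < f x"
      unfolding eventually_at_right_field
      using anti[of _ s] by (intro exI[of _ s]) (auto intro: less_le_trans simp: less_imp_le)
  next
    fix y assume y: "(SUP s\<in>{a<..b}. f s) < y"
    have "f x < y" if "a < x" "x < b" for x
      using that y by (intro le_less_trans[OF SUP_upper y]) auto
    then show "\<forall>\<^sub>F x in at_right a. f x < y"
      unfolding eventually_at_right_field using \<open>a < b\<close> by blast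
  qed
qed simp

lemma Lim_at_right_mono:
  fixes f :: "real \<Rightarrow> ereal"
  assumes "a < b" and mono: "\<And>s t. a < s \<Longrightarrow> s \<le> t \<Longrightarrow> t \<le> b \<Longrightarrow> f s \<le> f t"
  shows "Lim (at_right a) f = (INF s\<in>{a<..b}. f s)"
proof (rule tendsto_Lim)
  show "(f \<longlongrightarrow> (INF s\<in>{a<..b}. f s)) (at_right a)"
  proof (rule order_tendstoI)
    fix y assume "(INF s\<in>{a<..b}. f s) < y"
    then obtain s where s: "s \<in> {a<..b}" "f s < y" by (auto simp: INF_less_iff)
    then show "\<forall>\<^sub>F x in at_right a. f x < y"
      unfolding eventually_at_right_field
      using mono[of _ s] by (intro exI[of _ s]) (auto intro: le_less_trans[OF _ s(2)] simp: less_imp_le)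
  next
    fix y assume y: "y < (INF s\<in>{a<..b}. f s)"
    have "y < f x" if "a < x" "x < b" for x
      using that y by (intro less_le_trans[OF y INF_lower]) auto
    then show "\<forall>\<^sub>F x in at_right a. y < f x"
      unfolding eventually_at_right_field using \<open>a < b\<close> by blast
  qed
qed simp

lemma convex_on_slope_mono:
  fixes f :: "real \<Rightarrow> real"
  assumes "convex_on {a..b} f" "a < s" "s \<le> t" "t \<le> b"
  shows "(f s - f a) / (s - a) \<le> (f t - f a) / (t - a)"
proof -
  define l where "l = (s - a) / (t - a)"
  have l: "0 \<le> l" "l \<le> 1" using assms by (auto simp: l_def field_simps)
  have lm: "l * (t - a) = s - a" using assms by (simp add: l_def)
  have s: "s = (1 - l) * a + l * t" using lm by (simp add: algebra_simps)
  have "f s \<le> (1 - l) * f a + l * f t"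
    using convex_onD[OF assms(1) l, of a t] assms s by auto
  then have "f s - f a \<le> l * (f t - f a)" by (simp add: algebra_simps)
  then show ?thesis using assms by (simp add: l_def field_simps)
qed

section \<open>Inverse S-shaped functions and the slope condition\<close>

lemma ISS_convex:
  assumes "ISS h p"
  shows "convex_on {p..1} h" "convex_on {0..p} (\<lambda>x. - h x)"
    "continuous_on {p..1} h" "continuous_on {0..p} (\<lambda>x. - h x)"
proof -
  have iss: "0 < p" "p < 1" "continuous_on {0..1} h" "convex_on {0<..<p} (\<lambda>x. - h x)" "convex_on {p<..<1} h"
    using assms by (auto simp: ISS_def concave_on_def)
  show c: "continuous_on {p..1} h" "continuous_on {0..p} (\<lambda>x. - h x)"
    using iss by (auto intro!: continuous_on_minus intro: continuous_on_subset)
  show "convex_on {p..1} h" "convex_on {0..p} (\<lambda>x. - h x)"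
    using convex_on_closed_interval iss c by auto
qed

lemma ISS_basics:
  assumes "ISS h p"
  shows "0 < p" "p < 1" "h 0 = 0" "h 1 = 1" "\<And>x y. 0 \<le> x \<Longrightarrow> x \<le> y \<Longrightarrow> y \<le> 1 \<Longrightarrow> h x \<le> h y"
  using assms by (auto simp: ISS_def distortion_def mono_on_def)

text \<open>Chord slopes from 0 decrease on \<open>{0<..p}\<close> and those from \<open>p\<close>
  increase on \<open>{p<..1}\<close>, so the two derivatives are a supremum and an infimum;
  comparing them means comparing all pairs of quotients, which are real numbers.\<close>

lemma right_deriv_le_iff:
  assumes "ISS h p"
  shows "right_deriv h 0 \<le> right_deriv h p \<longleftrightarrow>
    (\<forall>s\<in>{0<..p}. \<forall>t\<in>{p<..1}. h s / s \<le> (h t - h p) / (t - p))"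
proof -
  note b = ISS_basics[OF assms] and c = ISS_convex[OF assms]
  have "right_deriv h 0 = (SUP s\<in>{0<..p}. ereal ((h s - h 0) / (s - 0)))"
    unfolding right_deriv_def
    by (rule Lim_at_right_antimono) (use b convex_on_slope_mono[OF c(2)] in auto)
  moreover have "right_deriv h p = (INF t\<in>{p<..1}. ereal ((h t - h p) / (t - p)))"
    unfolding right_deriv_def
    by (rule Lim_at_right_mono) (use b convex_on_slope_mono[OF c(1)] in auto)
  ultimately show ?thesis using b by (auto simp: SUP_le_iff le_INF_iff)
qed

lemma ISS_supporting_slope:
  assumes "ISS h p" and d: "\<forall>s\<in>{0<..p}. \<forall>t\<in>{p<..1}. h s / s \<le> (h t - h p) / (t - p)"
  obtains c where "\<And>x y. 0 \<le> x \<Longrightarrow> x \<le> y \<Longrightarrow> y \<le> p \<Longrightarrow> h y - h x \<le> c * (y - x)"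
    "\<And>x y. p \<le> x \<Longrightarrow> x \<le> y \<Longrightarrow> y \<le> 1 \<Longrightarrow> c * (y - x) \<le> h y - h x"
proof
  note b = ISS_basics[OF assms(1)] and c = ISS_convex[OF assms(1)]
  \<comment> \<open>\<open>c\<close> is the right derivative at 0; the chord slope from
    \<open>p\<close> to 1 bounds it from above.\<close>
  define c where "c = (SUP s\<in>{0<..p}. h s / s)"
  have bdd: "bdd_above ((\<lambda>s. h s / s) ` {0<..p})"
    using d b(1,2) by (intro bdd_aboveI2[where M = "(h 1 - h p) / (1 - p)"]) simp
  have 1: "h s \<le> c * s" if "0 \<le> s" "s \<le> p" for s
  proof (cases "s = 0")
    case False
    then have "h s / s \<le> c" unfolding c_def using that bdd by (intro cSUP_upper) auto
    then show ?thesis using that False by (simp add: field_simps)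
  qed (use b in simp)
  have 2: "c * (t - p) \<le> h t - h p" if "p \<le> t" "t \<le> 1" for t
  proof (cases "t = p")
    case False
    then have "c \<le> (h t - h p) / (t - p)" unfolding c_def using that d b by (intro cSUP_least) auto
    then show ?thesis using that False by (simp add: field_simps)
  qed simp
  \<comment> \<open>Each increment is compared with the one over an interval of the same length
    starting at 0 or at \<open>p\<close>, by concavity or convexity respectively.\<close>
  show "h y - h x \<le> c * (y - x)" if "0 \<le> x" "x \<le> y" "y \<le> p" for x y
    using convex_on_four_points[OF ISS_convex(2)[OF assms(1)], of 0 y x "y - x"] 1[of "y - x"] that b by auto
  show "c * (y - x) \<le> h y - h x" if "p \<le> x" "x \<le> y" "y \<le> 1" for x y
    using convex_on_four_points[OF ISS_convex(1)[OF assms(1)], of p y x "p + (y - x)"] 2[of "p + (y - x)"] that b by auto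
qed

section \<open>Finite-valued test variables\<close>

context prob_space
begin

text \<open>Of the two parts into which atomlessness splits an event, one has at most half its
  probability; iterated halving gets below \<open>e\<close>.\<close>

lemma atomless_small_subset:
  assumes "atomless M" "A \<in> events" "0 < prob A" "0 < e"
  obtains B where "B \<in> events" "B \<subseteq> A" "0 < prob B" "prob B < e"
proof -
  have "\<exists>B\<in>events. B \<subseteq> A \<and> 0 < prob B \<and> prob B \<le> prob A / 2 ^ n" for n
  proof (induction n)
    case (Suc n)
    then obtain B where B: "B \<in> events" "B \<subseteq> A" "0 < prob B" "prob B \<le> prob A / 2 ^ n" by auto
    then obtain D where D: "D \<in> events" "D \<subseteq> B" "0 < prob D" "prob D < prob B"
      using assms(1) unfolding atomless_def by blast
    have "prob (B - D) = prob B - prob D" using B D by (intro finite_measure_Diff)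
    moreover have "prob A / 2 ^ Suc n = (prob A / 2 ^ n) / 2" by simp
    ultimately have "prob D \<le> prob A / 2 ^ Suc n \<or> (0 < prob (B - D) \<and> prob (B - D) \<le> prob A / 2 ^ Suc n)"
      using B D by linarith
    then show ?case using B D by (meson Diff_subset order_trans sets.Diff)
  qed (use assms in auto)
  moreover obtain n where "prob A / 2 ^ n < e"
  proof -
    obtain n where "prob A / e < 2 ^ n" using real_arch_pow[of 2] by auto
    then show ?thesis using that assms by (auto simp: field_simps)
  qed
  ultimately show ?thesis using that by (meson le_less_trans)
qed

text \<open>Greedy exhaustion. \<open>P\<close> marks admissible sets, and \<open>Q B B'\<close>
  says that \<open>B'\<close> gains at least half of what any admissible addition to
  \<open>B\<close> could. If the union \<open>U\<close> fell short of \<open>r\<close>, a small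
  event outside \<open>U\<close> would remain an admissible addition at every step, so the gains
  could not tend to 0.\<close>

lemma sierpinski:
  assumes "atomless M" "A \<in> events" "0 \<le> r" "r \<le> prob A"
  obtains B where "B \<in> events" "B \<subseteq> A" "prob B = r"
proof -
  define P where "P B \<longleftrightarrow> B \<in> events \<and> B \<subseteq> A \<and> prob B \<le> r" for B
  define Q where "Q B B' \<longleftrightarrow> B \<subseteq> B' \<and>
    (\<forall>D\<in>events. D \<subseteq> A - B \<longrightarrow> prob B + prob D \<le> r \<longrightarrow> prob D \<le> 2 * (prob B' - prob B))" for B B'
  have step: "\<exists>B'. P B' \<and> Q B B'" if "P B" for B
  proof -
    define T where "T = prob ` {D\<in>events. D \<subseteq> A - B \<and> prob B + prob D \<le> r}"
    have bdd: "bdd_above T" by (auto simp: T_def intro!: bdd_aboveI[where M = 1])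
    have ne: "T \<noteq> {}" using that by (auto simp: T_def P_def intro!: exI[of _ "{}"])
    show ?thesis
    proof (cases "Sup T \<le> 0")
      case True
      have "prob D \<le> 0" if "D \<in> events" "D \<subseteq> A - B" "prob B + prob D \<le> r" for D
        using cSup_upper[OF _ bdd, of "prob D"] that True by (auto simp: T_def)
      then show ?thesis using that by (auto simp: Q_def intro!: exI[of _ B])
    next
      case False
      then obtain x where "x \<in> T" "Sup T / 2 < x" using less_cSup_iff[OF ne bdd, of "Sup T / 2"] by auto
      then obtain D where D: "D \<in> events" "D \<subseteq> A - B" "prob B + prob D \<le> r" "Sup T / 2 < prob D"
        by (auto simp: T_def)
      have u: "prob (B \<union> D) = prob B + prob D"
        using D that by (intro finite_measure_Union) (auto simp: P_def)
      have "prob D' \<le> 2 * prob D" if "D' \<in> events" "D' \<subseteq> A - B" "prob B + prob D' \<le> r" for D'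
        using cSup_upper[OF _ bdd, of "prob D'"] that D by (auto simp: T_def)
      then show ?thesis using that D u by (intro exI[of _ "B \<union> D"]) (auto simp: P_def Q_def)
    qed
  qed
  have "P {}" using assms by (auto simp: P_def)
  then obtain S where S: "\<And>n. P (S n)" "\<And>n. Q (S n) (S (Suc n))"
    using dependent_nat_choice[of "\<lambda>_. P" "\<lambda>_. Q"] step by metis
  define U where "U = (\<Union>n. S n)"
  have inc: "incseq S" using S(2) by (auto simp: Q_def intro!: incseq_SucI)
  have ev: "range S \<subseteq> events" using S(1) by (auto simp: P_def)
  have U: "U \<in> events" "U \<subseteq> A" using ev S(1) by (auto simp: U_def P_def)
  have lim: "(\<lambda>n. prob (S n)) \<longlonglongrightarrow> prob U"
    unfolding U_def by (rule finite_Lim_measure_incseq[OF ev inc])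
  have le: "prob U \<le> r" by (rule LIMSEQ_le_const2[OF lim]) (use S(1) in \<open>auto simp: P_def\<close>)
  have "prob U = r"
  proof (rule ccontr)
    assume "prob U \<noteq> r"
    then have lt: "prob U < r" using le by simp
    have "prob (A - U) = prob A - prob U" using U assms by (intro finite_measure_Diff) auto
    then obtain D where D: "D \<in> events" "D \<subseteq> A - U" "0 < prob D" "prob D < r - prob U"
      using atomless_small_subset[OF assms(1), of "A - U" "r - prob U"] assms U lt by auto
    have "prob D \<le> 2 * (prob (S (Suc n)) - prob (S n))" for n
    proof -
      have "prob (S n) \<le> prob U" using U by (intro finite_measure_mono) (auto simp: U_def)
      then show ?thesis using S(2)[of n] D unfolding Q_def U_def by fastforce
    qed
    moreover have "(\<lambda>n. 2 * (prob (S (Suc n)) - prob (S n))) \<longlonglongrightarrow> 2 * (prob U - prob U)"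
      by (intro tendsto_intros lim LIMSEQ_Suc[OF lim])
    ultimately have "prob D \<le> 2 * (prob U - prob U)" by (intro LIMSEQ_le_const) auto
    then show False using D by simp
  qed
  then show ?thesis using that U by auto
qed

lemma atomless_cells:
  assumes "atomless M" "0 \<le> a2" "a2 \<le> a1" "a1 \<le> 1"
    "0 \<le> b1" "b1 \<le> a2" "0 \<le> b2" "b2 \<le> a1 - a2" "0 \<le> b3" "b3 \<le> 1 - a1"
  obtains A1 A2 B where "A1 \<in> events" "A2 \<in> events" "B \<in> events" "A2 \<subseteq> A1"
    "prob A1 = a1" "prob A2 = a2"
    "prob (A2 \<inter> B) = b1" "prob ((A1 - A2) \<inter> B) = b2" "prob (B - A1) = b3"
proof -
  obtain A1 where A1: "A1 \<in> events" "prob A1 = a1"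
    using sierpinski[OF assms(1), of "space M" a1] assms by (auto simp: prob_space)
  obtain A2 where A2: "A2 \<in> events" "A2 \<subseteq> A1" "prob A2 = a2"
    using sierpinski[OF assms(1), of A1 a2] assms A1 by auto
  obtain B1 where B1: "B1 \<in> events" "B1 \<subseteq> A2" "prob B1 = b1"
    using sierpinski[OF assms(1), of A2 b1] assms A2 by auto
  have "prob (A1 - A2) = a1 - a2" using A1 A2 by (simp add: finite_measure_Diff)
  then obtain B2 where B2: "B2 \<in> events" "B2 \<subseteq> A1 - A2" "prob B2 = b2"
    using sierpinski[OF assms(1), of "A1 - A2" b2] assms A1 A2 by auto
  have "prob (space M - A1) = 1 - a1" using A1 by (simp add: prob_compl)
  then obtain B3 where B3: "B3 \<in> events" "B3 \<subseteq> space M - A1" "prob B3 = b3"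
    using sierpinski[OF assms(1), of "space M - A1" b3] assms A1 by auto
  have "A2 \<inter> (B1 \<union> B2 \<union> B3) = B1" "(A1 - A2) \<inter> (B1 \<union> B2 \<union> B3) = B2" "(B1 \<union> B2 \<union> B3) - A1 = B3"
    using B1 B2 B3 A2 by auto
  then show ?thesis using that[of A1 A2 "B1 \<union> B2 \<union> B3"] A1 A2 B1 B2 B3 by simp
qed

text \<open>The sum takes values in 0, 1, 2, 3 only, so its survival function is constant on three
  intervals of length 1, each of which contributes one value of \<open>h\<close>.\<close>

lemma distorted_expectation_sum_indicators:
  assumes h: "distortion h" and ev: "A1 \<in> events" "A2 \<in> events" "B \<in> events" "A2 \<subseteq> A1"
  shows "distorted_expectation M h (\<lambda>\<omega>. (indicator A1 \<omega> + indicator A2 \<omega>) + indicator B \<omega>)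
    = h (prob (A1 \<union> B)) + h (prob (A2 \<union> (A1 \<inter> B))) + h (prob (A2 \<inter> B))"
proof -
  define Z :: "'a \<Rightarrow> real" where "Z = (\<lambda>\<omega>. (indicator A1 \<omega> + indicator A2 \<omega>) + indicator B \<omega>)"
  have sub: "A1 \<subseteq> space M" "A2 \<subseteq> space M" "B \<subseteq> space M" using ev sets.sets_into_space by auto
  have h01: "h 0 = 0" "h 1 = 1" using h by (auto simp: distortion_def)
  have s0: "{\<omega>\<in>space M. Z \<omega> > x} = space M" if "x < 0" for x
    using that by (auto simp: Z_def indicator_def)
  have s1: "{\<omega>\<in>space M. Z \<omega> > x} = A1 \<union> B" if "0 \<le> x" "x < 1" for x
    using that sub ev(4) by (auto simp: Z_def indicator_def split: if_splits)
  have s2: "{\<omega>\<in>space M. Z \<omega> > x} = A2 \<union> (A1 \<inter> B)" if "1 \<le> x" "x < 2" for x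
    using that sub ev(4) by (auto simp: Z_def indicator_def split: if_splits)
  have s3: "{\<omega>\<in>space M. Z \<omega> > x} = A2 \<inter> B" if "2 \<le> x" "x < 3" for x
    using that sub ev(4) by (auto simp: Z_def indicator_def split: if_splits)
  have s4: "{\<omega>\<in>space M. Z \<omega> > x} = {}" if "3 \<le> x" for x
    using that by (auto simp: Z_def indicator_def split: if_splits)
  have "(LBINT x:{0..}. h (\<P>(\<omega> in M. Z \<omega> > x)))
    = (\<integral>x. h (prob (A1 \<union> B)) * indicator {0..<1::real} x + h (prob (A2 \<union> (A1 \<inter> B))) * indicator {1..<2::real} x
        + h (prob (A2 \<inter> B)) * indicator {2..<3::real} x \<partial>lborel)"
    unfolding set_lebesgue_integral_def
  proof (rule Bochner_Integration.integral_cong[OF refl])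
    fix x :: real
    consider "x < 0" | "0 \<le> x" "x < 1" | "1 \<le> x" "x < 2" | "2 \<le> x" "x < 3" | "3 \<le> x" by linarith
    then show "indicator {0..} x *\<^sub>R h (\<P>(\<omega> in M. Z \<omega> > x)) = h (prob (A1 \<union> B)) * indicator {0..<1} x + h (prob (A2 \<union> (A1 \<inter> B))) * indicator {1..<2} x
        + h (prob (A2 \<inter> B)) * indicator {2..<3} x"
      by cases (simp_all add: s1 s2 s3 s4 h01)
  qed
  also have "\<dots> = h (prob (A1 \<union> B)) + h (prob (A2 \<union> (A1 \<inter> B))) + h (prob (A2 \<inter> B))"
    by simp
  finally have 1: "(LBINT x:{0..}. h (\<P>(\<omega> in M. Z \<omega> > x))) = \<dots>" .
  have "(LBINT x:{..0}. h (\<P>(\<omega> in M. Z \<omega> > x)) - 1) = (LBINT x:{..0::real}. (0::real))"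
    unfolding set_lebesgue_integral_def
  proof (rule Bochner_Integration.integral_cong_AE)
    \<comment> \<open>The half-line contains 0, where the integrand need not vanish; it is zero for
      negative \<open>x\<close>, hence almost everywhere.\<close>
    have "indicator {..0} x *\<^sub>R (h (\<P>(\<omega> in M. Z \<omega> > x)) - 1) = (h (prob (A1 \<union> B)) - 1) * indicator {0} x" for x :: real
      by (cases x "0::real" rule: linorder_cases) (simp_all add: s0 s1 h01 prob_space)
    then show "(\<lambda>x. indicator {..0} x *\<^sub>R (h (\<P>(\<omega> in M. Z \<omega> > x)) - 1)) \<in> borel_measurable lborel"
      by simp
    show "AE x in lborel. indicator {..0} x *\<^sub>R (h (\<P>(\<omega> in M. Z \<omega> > x)) - 1) = indicator {..0} x *\<^sub>R 0"
      using AE_lborel_singleton[of 0] by eventually_elim (auto simp: indicator_def s0 h01 prob_space)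
  qed simp
  then show ?thesis using 1 by (simp add: distorted_expectation_def Z_def set_lebesgue_integral_def)
qed

end

text \<open>All claims concern masses of quadrants under the law \<open>N\<close>. The Frechet bound
  is inclusion-exclusion for two half-planes, and the Lipschitz bound is the mass of the strip
  between \<open>u\<close> and \<open>u'\<close>.\<close>

lemma copula_bounds:
  assumes "copula C" and u: "u \<in> {0..1}" and v: "v \<in> {0..1}"
  shows "0 \<le> C u v" "u + v - 1 \<le> C u v" "C u v \<le> v"
    "C 0 v = 0" "C 1 v = v" "C u 0 = 0" "C u 1 = u"
    and "\<And>u'. u' \<in> {u..1} \<Longrightarrow> C u v \<le> C u' v \<and> C u' v - C u v \<le> u' - u"
proof -
  obtain N :: "(real \<times> real) measure" where N: "prob_space N" "sets N = sets borel"
      "distr N borel fst = uniform_measure lborel {0..1}"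
      "distr N borel snd = uniform_measure lborel {0..1}"
      and C: "\<And>u v. u \<in> {0..1} \<Longrightarrow> v \<in> {0..1} \<Longrightarrow> C u v = measure N ({..u} \<times> {..v})"
    using assms(1) unfolding copula_def by blast
  interpret N: prob_space N by fact
  have sp: "space N = UNIV" using sets_eq_imp_space_eq[OF N(2)] by simp
  have meas[measurable]: "fst \<in> borel_measurable N" "snd \<in> borel_measurable N"
    using measurable_cong_sets[OF N(2) refl, of "borel :: real measure"] borel_measurable_continuous_onI[of fst] borel_measurable_continuous_onI[of snd]
    by (auto simp: continuous_on_fst continuous_on_snd continuous_on_id)
  have ms: "{..a} \<times> {..b} \<in> sets N" "{..a} \<times> UNIV \<in> sets N" "UNIV \<times> {..b} \<in> sets N" for a b :: real
  proof -
    have "{..a} \<times> {..b} = {x\<in>space N. fst x \<le> a \<and> snd x \<le> b}" "{..a} \<times> UNIV = {x\<in>space N. fst x \<le> a}"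
      "UNIV \<times> {..b} = {x\<in>space N. snd x \<le> b}" by (auto simp: sp)
    then show "{..a} \<times> {..b} \<in> sets N" "{..a} \<times> UNIV \<in> sets N" "UNIV \<times> {..b} \<in> sets N" by simp_all
  qed
  have unif: "measure (uniform_measure lborel {0..1}) {..a} = a" if "a \<in> {0..1}" for a :: real
  proof -
    have "{0..1} \<inter> {..a} = {0..a}" using that by auto
    then show ?thesis using that by (simp add: measure_uniform_measure)
  qed
  have fs: "measure N ({..a} \<times> UNIV) = a" "measure N (UNIV \<times> {..a}) = a" if "a \<in> {0..1}" for a
  proof -
    have "fst -` {..a} \<inter> space N = {..a} \<times> UNIV" "snd -` {..a} \<inter> space N = UNIV \<times> {..a}" by (auto simp: sp)
    then show "measure N ({..a} \<times> UNIV) = a" "measure N (UNIV \<times> {..a}) = a"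
      using unif[OF that] N(3,4) measure_distr[of fst N borel "{..a}"] measure_distr[of snd N borel "{..a}"]
      by auto
  qed
  have inter: "({..a} \<times> UNIV) \<inter> (UNIV \<times> {..b}) = {..a} \<times> {..b}" for a b :: real by auto
  have low: "a + b - 1 \<le> C a b" "C a b \<le> a" "C a b \<le> b" "0 \<le> C a b" if "a \<in> {0..1}" "b \<in> {0..1}" for a b
  proof -
    have "measure N (({..a} \<times> UNIV) \<union> (UNIV \<times> {..b})) = a + b - C a b"
      using measure_Un3[OF _ _ , of "{..a} \<times> UNIV" N "UNIV \<times> {..b}"] ms N.fmeasurable_eq_sets fs that C[OF that]
      by (simp add: inter)
    then show "a + b - 1 \<le> C a b" using N.prob_le_1[of "({..a} \<times> UNIV) \<union> (UNIV \<times> {..b})"] by simp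
    show "C a b \<le> a" "C a b \<le> b" "0 \<le> C a b"
      using fs(1)[OF that(1)] fs(2)[OF that(2)] C[OF that]
        N.finite_measure_mono[of "{..a} \<times> {..b}" "{..a} \<times> UNIV"]
        N.finite_measure_mono[of "{..a} \<times> {..b}" "UNIV \<times> {..b}"] ms by auto
  qed
  show "0 \<le> C u v" "u + v - 1 \<le> C u v" "C u v \<le> v"
    "C 0 v = 0" "C 1 v = v" "C u 0 = 0" "C u 1 = u"
    using low[OF u v] low[of 0 v] low[of 1 v] low[of u 0] low[of u 1] u v by auto
  fix u' assume u': "u' \<in> {u..1}"
  then have u'1: "u' \<in> {0..1}" using u by auto
  have "{..u'} \<times> {..v} \<subseteq> {..u} \<times> {..v} \<union> ({..u'} \<times> UNIV - {..u} \<times> UNIV)" by auto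
  then have "measure N ({..u'} \<times> {..v}) \<le> measure N ({..u} \<times> {..v} \<union> ({..u'} \<times> UNIV - {..u} \<times> UNIV))"
    using ms by (intro N.finite_measure_mono) auto
  also have "\<dots> \<le> measure N ({..u} \<times> {..v}) + measure N ({..u'} \<times> UNIV - {..u} \<times> UNIV)"
    using ms by (intro measure_Un_le) auto
  also have "measure N ({..u'} \<times> UNIV - {..u} \<times> UNIV) = u' - u"
    using ms u' fs(1)[OF u] fs(1)[OF u'1] by (subst N.finite_measure_Diff) auto
  finally have "C u' v - C u v \<le> u' - u" using C u v u'1 by simp
  moreover have "C u v \<le> C u' v"
    using u' ms C[OF u v] C[OF u'1 v] by (auto intro!: N.finite_measure_mono)
  ultimately show "C u v \<le> C u' v \<and> C u' v - C u v \<le> u' - u" by simp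
qed

text \<open>Test variables: \<open>X\<close> takes the values 0, 1, 2 with \<open>P (X \<le> 0) = u0\<close> and \<open>P (X \<le> 1) = u1\<close>, and
  \<open>Y\<close> is the indicator of an event of probability \<open>1 - v\<close>, which a competing coupling splits into
  parts of sizes \<open>g3\<close>, \<open>g2\<close>, \<open>g1\<close> on the three levels of \<open>X\<close>. With \<open>u1 = 1\<close> both variables are two-valued.\<close>

lemma (in prob_space) universally_optimal_test:
  assumes at: "atomless M" and C: "copula C" and h: "distortion h" and opt: "universally_optimal M h C"
    and u: "0 \<le> u0" "u0 \<le> u1" "u1 \<le> 1" and v: "v \<in> {0..1}"
    and g: "0 \<le> g1" "g1 \<le> 1 - u1" "0 \<le> g2" "g2 \<le> u1 - u0" "0 \<le> g3" "g3 \<le> u0" "g1 + g2 + g3 = 1 - v"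
  shows "h (1 - C u0 v) + h (1 - u0 + C u0 v - C u1 v) + h (1 - u1 - v + C u1 v)
    \<le> h (1 - u0 + g3) + h (1 - u1 + g2) + h g1"
proof -
  have u01: "u0 \<in> {0..1}" "u1 \<in> {0..1}" "u1 \<in> {u0..1}" using u by auto
  note c0 = copula_bounds(1-7)[OF C u01(1) v] and c1 = copula_bounds(1-7)[OF C u01(2) v] and c01 = copula_bounds(8)[OF C u01(1) v u01(3)]
  \<comment> \<open>This is the Lipschitz bound starting from \<open>C 0 v = 0\<close>.\<close>
  have c0u: "C u0 v \<le> u0" using copula_bounds(8)[OF C _ v, of 0 u0] c0 u01 by auto
  \<comment> \<open>Every split of the event of \<open>Y\<close> over the three levels of
    \<open>X\<close> is realised with the same marginals. This is used once for the split prescribed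
    by \<open>C\<close> and once for \<open>g1\<close>, \<open>g2\<close>,
    \<open>g3\<close>.\<close>
  have test: "\<exists>X Y. X \<in> bounded_rvs M \<and> Y \<in> bounded_rvs M
      \<and> (\<forall>x. \<P>(\<omega> in M. X \<omega> \<le> x) = (if x < 0 then 0 else if x < 1 then u0 else if x < 2 then u1 else 1))
      \<and> (\<forall>y. \<P>(\<omega> in M. Y \<omega> \<le> y) = (if y < 0 then 0 else if y < 1 then v else 1))
      \<and> (\<forall>x y. \<P>(\<omega> in M. X \<omega> \<le> x \<and> Y \<omega> \<le> y) = (if x < 0 \<or> y < 0 then 0
           else if 1 \<le> y then \<P>(\<omega> in M. X \<omega> \<le> x) else if x < 1 then u0 - b3 else if x < 2 then u1 - b2 - b3 else v))
      \<and> distorted_expectation M h (\<lambda>\<omega>. X \<omega> + Y \<omega>) = h (1 - u0 + b3) + h (1 - u1 + b2) + h b1"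
    if b: "0 \<le> b1" "b1 \<le> 1 - u1" "0 \<le> b2" "b2 \<le> u1 - u0" "0 \<le> b3" "b3 \<le> u0" "b1 + b2 + b3 = 1 - v" for b1 b2 b3
  proof -
    obtain A1 A2 B where ev[measurable]: "A1 \<in> events" "A2 \<in> events" "B \<in> events" and sub: "A2 \<subseteq> A1"
      and P: "prob A1 = 1 - u0" "prob A2 = 1 - u1"
        "prob (A2 \<inter> B) = b1" "prob ((A1 - A2) \<inter> B) = b2" "prob (B - A1) = b3"
      using atomless_cells[OF at, of "1 - u1" "1 - u0" b1 b2 b3] u b by auto
    have p1: "prob (A1 \<union> B) = 1 - u0 + b3"
      using finite_measure_Union[of A1 "B - A1"] P ev by (auto simp: Un_Diff_cancel)
    have "A2 \<union> (A1 \<inter> B) = A2 \<union> ((A1 - A2) \<inter> B)" using sub by auto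
    then have p2: "prob (A2 \<union> (A1 \<inter> B)) = 1 - u1 + b2"
      using finite_measure_Union[of A2 "(A1 - A2) \<inter> B"] P ev by auto
    have "A2 \<union> B = A2 \<union> (((A1 - A2) \<inter> B) \<union> (B - A1))" using sub by auto
    moreover have "A2 \<inter> ((A1 - A2) \<inter> B \<union> (B - A1)) = {}" "(A1 - A2) \<inter> B \<inter> (B - A1) = {}"
      using sub by auto
    ultimately have p3: "prob (A2 \<union> B) = 1 - u1 + b2 + b3"
      using finite_measure_Union[of A2 "((A1 - A2) \<inter> B) \<union> (B - A1)"]
        finite_measure_Union[of "(A1 - A2) \<inter> B" "B - A1"] P ev sub by auto
    have "B = (A2 \<inter> B) \<union> (((A1 - A2) \<inter> B) \<union> (B - A1))" using sub by auto
    moreover have "A2 \<inter> B \<inter> ((A1 - A2) \<inter> B \<union> (B - A1)) = {}" "(A1 - A2) \<inter> B \<inter> (B - A1) = {}"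
      using sub by auto
    ultimately have p4: "prob B = 1 - v"
      using finite_measure_Union[of "A2 \<inter> B" "((A1 - A2) \<inter> B) \<union> (B - A1)"]
        finite_measure_Union[of "(A1 - A2) \<inter> B" "B - A1"] P ev sub b(7) by auto
    define X :: "'a \<Rightarrow> real" where "X = (\<lambda>\<omega>. indicator A1 \<omega> + indicator A2 \<omega>)"
    define Y :: "'a \<Rightarrow> real" where "Y = indicator B"
    have "X \<in> bounded_rvs M" "Y \<in> bounded_rvs M"
      by (auto simp: bounded_rvs_def X_def Y_def indicator_def intro!: boundedI[where B = 2] borel_measurable_indicator ev)
    moreover have X: "\<P>(\<omega> in M. X \<omega> \<le> x) = (if x < 0 then 0 else if x < 1 then u0 else if x < 2 then u1 else 1)" for x
    proof -
      have "{\<omega>\<in>space M. X \<omega> \<le> x} = (if x < 0 then {} else if x < 1 then space M - A1 else if x < 2 then space M - A2 else space M)"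
        using sub by (auto simp: X_def indicator_def split: if_splits)
      then show ?thesis using P by (simp add: prob_compl prob_space)
    qed
    moreover have "\<P>(\<omega> in M. Y \<omega> \<le> y) = (if y < 0 then 0 else if y < 1 then v else 1)" for y
    proof -
      have "{\<omega>\<in>space M. Y \<omega> \<le> y} = (if y < 0 then {} else if y < 1 then space M - B else space M)"
        by (auto simp: Y_def indicator_def split: if_splits)
      then show ?thesis using p4 by (simp add: prob_compl prob_space)
    qed
    moreover have "\<P>(\<omega> in M. X \<omega> \<le> x \<and> Y \<omega> \<le> y) = (if x < 0 \<or> y < 0 then 0
           else if 1 \<le> y then \<P>(\<omega> in M. X \<omega> \<le> x) else if x < 1 then u0 - b3 else if x < 2 then u1 - b2 - b3 else v)" for x y
    proof -
      have "{\<omega>\<in>space M. X \<omega> \<le> x \<and> Y \<omega> \<le> y} = (if x < 0 \<or> y < 0 then {}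
           else if 1 \<le> y then {\<omega>\<in>space M. X \<omega> \<le> x} else if x < 1 then space M - (A1 \<union> B) else if x < 2 then space M - (A2 \<union> B)
           else space M - B)"
        using sub by (auto simp: X_def Y_def indicator_def split: if_splits)
      then show ?thesis using p1 p3 p4 by (simp add: prob_compl)
    qed
    moreover have "distorted_expectation M h (\<lambda>\<omega>. X \<omega> + Y \<omega>) = h (1 - u0 + b3) + h (1 - u1 + b2) + h b1"
      using distorted_expectation_sum_indicators[OF h ev sub] p1 p2 P by (simp add: X_def Y_def)
    ultimately show ?thesis by blast
  qed
  \<comment> \<open>The three arguments given to \<open>test\<close> are the masses that
    \<open>C\<close> assigns to \<open>Y = 1\<close> on \<open>X = 2\<close>, \<open>X = 1\<close>
    and \<open>X = 0\<close>.\<close>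
  obtain X Y where XY: "X \<in> bounded_rvs M" "Y \<in> bounded_rvs M"
      "\<And>x. \<P>(\<omega> in M. X \<omega> \<le> x) = (if x < 0 then 0 else if x < 1 then u0 else if x < 2 then u1 else 1)"
      "\<And>y. \<P>(\<omega> in M. Y \<omega> \<le> y) = (if y < 0 then 0 else if y < 1 then v else 1)"
      "\<And>x y. \<P>(\<omega> in M. X \<omega> \<le> x \<and> Y \<omega> \<le> y) = (if x < 0 \<or> y < 0 then 0
           else if 1 \<le> y then \<P>(\<omega> in M. X \<omega> \<le> x) else if x < 1 then C u0 v else if x < 2 then C u1 v else v)"
      "distorted_expectation M h (\<lambda>\<omega>. X \<omega> + Y \<omega>) =
         h (1 - C u0 v) + h (1 - u0 + C u0 v - C u1 v) + h (1 - u1 - v + C u1 v)"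
    using test[of "1 - u1 - v + C u1 v" "u1 - u0 + C u0 v - C u1 v" "u0 - C u0 v"] c0 c1 c01 c0u
    by (auto simp: algebra_simps)
  obtain X' Y' where XY': "X' \<in> bounded_rvs M" "Y' \<in> bounded_rvs M"
      "\<And>x. \<P>(\<omega> in M. X' \<omega> \<le> x) = (if x < 0 then 0 else if x < 1 then u0 else if x < 2 then u1 else 1)"
      "\<And>y. \<P>(\<omega> in M. Y' \<omega> \<le> y) = (if y < 0 then 0 else if y < 1 then v else 1)"
      "distorted_expectation M h (\<lambda>\<omega>. X' \<omega> + Y' \<omega>) = h (1 - u0 + g3) + h (1 - u1 + g2) + h g1"
    using test[OF g] by blast
  have law: "eq_in_law M V W" if "V \<in> bounded_rvs M" "W \<in> bounded_rvs M"
    "\<And>x. \<P>(\<omega> in M. V \<omega> \<le> x) = \<P>(\<omega> in M. W \<omega> \<le> x)" for V W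
  proof -
    have [measurable]: "V \<in> borel_measurable M" "W \<in> borel_measurable M" using that by (auto simp: bounded_rvs_def)
    interpret V: real_distribution "distr M borel V" by (rule real_distribution_distr) simp
    interpret W: real_distribution "distr M borel W" by (rule real_distribution_distr) simp
    have "cdf (distr M borel V) x = cdf (distr M borel W) x" for x
      using that(3)[of x] by (simp add: cdf_def measure_distr vimage_def Int_def conj_commute)
    then show ?thesis unfolding eq_in_law_def
      by (intro cdf_unique V.real_distribution_axioms W.real_distribution_axioms) auto
  qed
  have "copula_of M C X Y"
    unfolding copula_of_def
  proof (intro allI)
    fix x y :: real
    have "C 0 0 = 0" "C 0 1 = 0" "C 1 0 = 0" "C 1 1 = 1" "C u0 0 = 0" "C u1 0 = 0" "C u0 1 = u0" "C u1 1 = u1"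
      "C 0 v = 0" "C 1 v = v"
      using copula_bounds(4-7)[OF C, of 0 1] copula_bounds(4-7)[OF C, of 1 0] c0 c1 copula_bounds(4-7)[OF C u01(1), of 1] by auto
    then show "\<P>(\<omega> in M. X \<omega> \<le> x \<and> Y \<omega> \<le> y) = C (\<P>(\<omega> in M. X \<omega> \<le> x)) (\<P>(\<omega> in M. Y \<omega> \<le> y))"
      unfolding XY(3-5) by auto
  qed
  moreover have "eq_in_law M X' X" "eq_in_law M Y' Y"
    using law XY XY' by simp_all
  ultimately have "distorted_expectation M h (\<lambda>\<omega>. X \<omega> + Y \<omega>) \<le> distorted_expectation M h (\<lambda>\<omega>. X' \<omega> + Y' \<omega>)"
    using opt XY XY' unfolding universally_optimal_def by blast
  then show ?thesis using XY XY' by simp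
qed

section \<open>Necessity\<close>

lemma strictly_ISS_four_points:
  assumes "strictly_ISS h p"
  shows "\<And>x y z t. p \<le> x \<Longrightarrow> x < y \<Longrightarrow> y < t \<Longrightarrow> t \<le> 1 \<Longrightarrow> y + z = x + t \<Longrightarrow> h y + h z < h x + h t"
    and "\<And>x y z t. 0 \<le> x \<Longrightarrow> x < y \<Longrightarrow> y < t \<Longrightarrow> t \<le> p \<Longrightarrow> y + z = x + t \<Longrightarrow> h x + h t < h y + h z"
proof -
  have iss: "ISS h p" and s: "strictly_convex_on {p<..<1} h" "strictly_convex_on {0<..<p} (\<lambda>x. - h x)"
    using assms by (auto simp: strictly_ISS_def strictly_concave_on_def)
  show "h y + h z < h x + h t" if "p \<le> x" "x < y" "y < t" "t \<le> 1" "y + z = x + t" for x y z t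
    by (rule strictly_convex_on_four_points[OF s(1) ISS_convex(3)[OF iss] that])
  show "h x + h t < h y + h z" if "0 \<le> x" "x < y" "y < t" "t \<le> p" "y + z = x + t" for x y z t
    using strictly_convex_on_four_points[OF s(2) ISS_convex(4)[OF iss] that] by simp
qed

context prob_space
begin

text \<open>If the slope condition failed, it would be cheaper to keep a small upper event of \<open>Y\<close> away from
  the upper event of \<open>X\<close> of probability \<open>p + e\<close>; but for a three-valued \<open>X\<close> with levels at \<open>p\<close>
  and \<open>p + e\<close> it is cheapest to put that event between the two levels.\<close>

lemma universally_optimal_imp_slope_le:
  assumes at: "atomless M" and C: "copula C" and si: "strictly_ISS h p" and opt: "universally_optimal M h C"
    and s0: "s0 \<in> {0<..p}" and t0: "t0 \<in> {p<..1}"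
  shows "h s0 / s0 \<le> (h t0 - h p) / (t0 - p)"
proof (rule ccontr)
  have iss: "ISS h p" and h: "distortion h" using si by (auto simp: strictly_ISS_def ISS_def)
  note b = ISS_basics[OF iss] and c = ISS_convex[OF iss]
  define k where "k = h s0 / s0"
  assume "\<not> h s0 / s0 \<le> (h t0 - h p) / (t0 - p)"
  then have lt: "h t0 - h p - k * (t0 - p) < 0"
    using t0 by (simp add: k_def[symmetric] field_simps)
  have "continuous (at p within {p..1}) h"
    using c(3) b by (simp add: continuous_on_eq_continuous_within)
  then have "(h \<longlongrightarrow> h p) (at p within {p..1})" by (simp add: continuous_within)
  then have "(h \<longlongrightarrow> h p) (at_right p)"
    using at_within_Icc_at_right[of p 1] b by simp
  then have "((\<lambda>s. h t0 - h s - k * (t0 - s)) \<longlongrightarrow> h t0 - h p - k * (t0 - p)) (at_right p)"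
    by (intro tendsto_intros)
  then have "\<forall>\<^sub>F s in at_right p. h t0 - h s - k * (t0 - s) < 0"
    using lt by (rule order_tendstoD)
  then obtain d0 where d0: "d0 > p" "\<And>s. p < s \<Longrightarrow> s < d0 \<Longrightarrow> h t0 - h s - k * (t0 - s) < 0"
    unfolding eventually_at_right_field by blast
  \<comment> \<open>\<open>e\<close> keeps \<open>p + 2 * e\<close> below \<open>t0\<close> and in
    the range where chords to \<open>t0\<close> have slope less than \<open>k\<close>; being below
    \<open>s0\<close>, it also makes \<open>h B / B\<close> at least \<open>k\<close> for
    \<open>0 < B \<le> e\<close>.\<close>
  define e where "e = min (min (d0 - p) (t0 - p)) s0 / 4"
  have e: "0 < e" "p + 2 * e < d0" "p + 2 * e < t0" "e < s0" using d0(1) t0 s0 by (auto simp: e_def min_def field_simps)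
  define u0 v where "u0 = 1 - p - e" and "v = 1 - e"
  have e1: "p + 2 * e < 1" using e t0 by auto
  have uv: "u0 \<in> {0..1}" "v \<in> {0..1}" using b e e1 by (auto simp: u0_def v_def)
  note cb = copula_bounds(1-7)[OF C uv] and cv = copula_bounds(5)[OF C uv]
  \<comment> \<open>The overlap that \<open>C\<close> gives to upper events of probabilities
    \<open>p + e\<close> and \<open>e\<close>.\<close>
  define B where "B = 1 - u0 - v + C u0 v"
  have B0: "0 \<le> B" using cb by (simp add: B_def)
  have Be: "B \<le> e" using copula_bounds(8)[OF C _ uv(2), of 0 u0] uv cb by (simp add: B_def v_def)
  have "B = 0"
  proof (rule ccontr)
    assume "B \<noteq> 0"
    then have Bp: "0 < B" using B0 by simp
    \<comment> \<open>Optimality against the disjoint coupling requires \<open>h B\<close> to be at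
      most the increment of \<open>h\<close> from \<open>p + 2 * e - B\<close> to
      \<open>p + 2 * e\<close>. But that increment is below \<open>k * B\<close>, while
      \<open>h B\<close> is at least \<open>k * B\<close>.\<close>
    have "h (1 - C u0 v) + h (1 - u0 + C u0 v - C 1 v) + h (1 - 1 - v + C 1 v)
      \<le> h (1 - u0 + e) + h (1 - 1 + 0) + h 0"
      by (rule universally_optimal_test[OF at C h opt]) (use uv e e1 b in \<open>auto simp: u0_def v_def\<close>)
    moreover have "1 - C u0 v = p + 2 * e - B" "1 - u0 + C u0 v - C 1 v = B" "1 - 1 - v + C 1 v = 0"
      "1 - u0 + e = p + 2 * e"
      using cv by (auto simp: B_def u0_def v_def)
    ultimately have "h (p + 2 * e - B) + h B \<le> h (p + 2 * e)" using b by simp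
    moreover have "(h (p + 2 * e) - h (p + 2 * e - B)) / B
        \<le> (h t0 - h (p + 2 * e - B)) / (t0 - (p + 2 * e - B))"
      using convex_on_slope_mono[of "p + 2 * e - B" 1 h "p + 2 * e" t0] e t0 Bp Be
        convex_on_subset[OF c(1), of "{p + 2 * e - B..1}"] by simp
    moreover have "(h t0 - h (p + 2 * e - B)) / (t0 - (p + 2 * e - B)) < k"
      using d0(2)[of "p + 2 * e - B"] e Bp Be by (simp add: field_simps)
    moreover have "k \<le> h B / B"
      using convex_on_slope_mono[OF c(2), of B s0] e Bp Be s0 b by (simp add: k_def)
    ultimately have "h (p + 2 * e - B) + h B \<le> h (p + 2 * e)"
        "(h (p + 2 * e) - h (p + 2 * e - B)) / B < h B / B"
      by linarith+
    then show False using Bp by (simp add: divide_less_cancel)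
  qed
  then have C0: "C u0 v = u0 + v - 1" by (simp add: B_def)
  have u1: "1 - p \<in> {0..1}" "1 - p \<in> {u0..1}" using b e by (auto simp: u0_def)
  \<comment> \<open>By the Lipschitz bound, equality in the Frechet bound at \<open>u0\<close>
    persists at larger first arguments; so in the next test the event of \<open>Y\<close> avoids
    both upper levels of \<open>X\<close>.\<close>
  have C1: "C (1 - p) v = (1 - p) + v - 1"
    using copula_bounds(2)[OF C u1(1) uv(2)] copula_bounds(8)[OF C uv u1(2)] C0 by simp
  have "h (1 - C u0 v) + h (1 - u0 + C u0 v - C (1 - p) v) + h (1 - (1 - p) - v + C (1 - p) v)
      \<le> h (1 - u0 + 0) + h (1 - (1 - p) + e) + h 0"
    by (rule universally_optimal_test[OF at C h opt]) (use uv e e1 b in \<open>auto simp: u0_def v_def\<close>)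
  moreover have "1 - C u0 v = p + 2 * e" "1 - u0 + C u0 v - C (1 - p) v = p" "1 - (1 - p) - v + C (1 - p) v = 0"
      "1 - u0 + 0 = p + e" "1 - (1 - p) + e = p + e"
    unfolding C0 C1 by (auto simp: u0_def v_def)
  ultimately have "h (p + 2 * e) + h p \<le> h (p + e) + h (p + e)" using b by simp
  moreover have "h (p + e) + h (p + e) < h p + h (p + 2 * e)"
    by (rule strictly_ISS_four_points(1)[OF si]) (use e e1 in auto)
  ultimately show False by simp
qed

text \<open>\<open>\<alpha>\<close> is the probability of the union of upper events of mass
  \<open>1 - u\<close> and \<open>1 - v\<close>, and \<open>s - \<alpha>\<close> that of their
  intersection. Tests with indicators make \<open>\<alpha>\<close> a minimiser of
  \<open>h x + h (s - x)\<close> over the admissible \<open>x\<close>, and \<open>\<alpha>0\<close>,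
  the value belonging to \<open>C_pm\<close>, beats every other one strictly.\<close>

lemma universally_optimal_imp_C_pm:
  assumes at: "atomless M" and C: "copula C" and si: "strictly_ISS h p" and opt: "universally_optimal M h C"
    and u: "u \<in> {0..1}" and v: "v \<in> {0..1}"
  shows "C u v = C_pm p u v"
proof (rule ccontr)
  assume ne: "C u v \<noteq> C_pm p u v"
  have iss: "ISS h p" and h: "distortion h" using si by (auto simp: strictly_ISS_def ISS_def)
  note b = ISS_basics[OF iss] and fp = strictly_ISS_four_points[OF si]
  obtain c where c: "\<And>x y. 0 \<le> x \<Longrightarrow> x \<le> y \<Longrightarrow> y \<le> p \<Longrightarrow> h y - h x \<le> c * (y - x)"
    "\<And>x y. p \<le> x \<Longrightarrow> x \<le> y \<Longrightarrow> y \<le> 1 \<Longrightarrow> c * (y - x) \<le> h y - h x"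
    using ISS_supporting_slope[OF iss] universally_optimal_imp_slope_le[OF at C si opt] by blast
  \<comment> \<open>The bound on the first half of the interval becomes strict on the whole of it by
    strict midpoint convexity.\<close>
  have c': "c * (y - x) < h y - h x" if "p \<le> x" "x < y" "y \<le> 1" for x y
    using fp(1)[of x "(x + y) / 2" y "(x + y) / 2"] c(2)[of x "(x + y) / 2"] that
    by (simp add: field_simps)
  define s where "s = 2 - u - v"
  define \<alpha> where "\<alpha> = 1 - C u v"
  have cu: "C u v \<le> u" using copula_bounds(8)[OF C _ v, of 0 u] copula_bounds(4)[OF C u v] u by auto
  have al: "1 - u \<le> \<alpha>" "1 - v \<le> \<alpha>" "\<alpha> \<le> 1" "\<alpha> \<le> s"
    using copula_bounds(1-3)[OF C u v] cu by (auto simp: \<alpha>_def s_def)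
  have test: "h \<alpha> + h (s - \<alpha>) \<le> h x + h (s - x)" if "1 - u \<le> x" "1 - v \<le> x" "x \<le> 1" "x \<le> s" for x
    using universally_optimal_test[OF at C h opt, of u 1 v 0 "s - x" "x - (1 - u)"] that u v
      copula_bounds(5)[OF C u v] by (simp add: \<alpha>_def s_def algebra_simps)
  \<comment> \<open>The admissible value nearest to \<open>p\<close>.\<close>
  define \<alpha>0 where "\<alpha>0 = (if min u v \<le> 1 - p then max (1 - u) (1 - v) else min s p)"
  have a0: "1 - u \<le> \<alpha>0" "1 - v \<le> \<alpha>0" "\<alpha>0 \<le> 1" "\<alpha>0 \<le> s"
    using u v b by (auto simp: \<alpha>0_def s_def)
  have neq: "\<alpha> \<noteq> \<alpha>0"
    using ne u v b by (auto simp: C_pm_def \<alpha>_def \<alpha>0_def s_def min_def max_def split: if_splits)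
  have "h \<alpha>0 + h (s - \<alpha>0) < h \<alpha> + h (s - \<alpha>)"
  proof (cases "\<alpha> < \<alpha>0")
    case True
    \<comment> \<open>Both pairs of arguments lie in \<open>{0..p}\<close>, where strict concavity
      favours the wider pair.\<close>
    then have "\<not> min u v \<le> 1 - p" using al by (auto simp: \<alpha>0_def)
    then have "\<alpha>0 \<le> p" by (simp add: \<alpha>0_def)
    moreover have "s - \<alpha>0 < \<alpha>" using True al by (simp add: s_def)
    ultimately show ?thesis
      using fp(2)[of "s - \<alpha>0" \<alpha> \<alpha>0 "s - \<alpha>"] True a0 by simp
  next
    case False
    then have lt: "\<alpha>0 < \<alpha>" using neq by simp
    then have p: "p \<le> \<alpha>0" using al by (auto simp: \<alpha>0_def split: if_splits)
    \<comment> \<open>Passing from \<open>\<alpha>0\<close> to \<open>\<alpha>\<close> raises the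
      larger argument above \<open>p\<close>, at slope more than \<open>c\<close>, and lowers the
      smaller one, which saves at most slope \<open>c\<close> once it is below
      \<open>p\<close>.\<close>
    show ?thesis
    proof (cases "s - \<alpha>0 \<le> p")
      case True
      then show ?thesis
        using c(1)[of "s - \<alpha>" "s - \<alpha>0"] c'[of \<alpha>0 \<alpha>] lt al p by simp
    next
      case False
      \<comment> \<open>The smaller argument is lowered in two stages: to \<open>y\<close>, not
        below \<open>p\<close>, where strict convexity penalises spreading, and then further if need
        be, where the slope \<open>c\<close> decides. \<open>x\<close> is the larger argument after
        the first stage.\<close>
      define y where "y = max (s - \<alpha>) p"
      define x where "x = \<alpha>0 + (s - \<alpha>0 - y)"
      have y: "p \<le> y" "y < s - \<alpha>0" "s - \<alpha> \<le> y" using False lt by (auto simp: y_def)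
      have "s - \<alpha>0 \<le> \<alpha>0" using False p b u v by (auto simp: \<alpha>0_def s_def max_def split: if_splits)
      then have x: "\<alpha>0 < x" "x \<le> \<alpha>" using y by (auto simp: x_def)
      have "h \<alpha>0 + h (s - \<alpha>0) < h y + h x"
        using y x \<open>s - \<alpha>0 \<le> \<alpha>0\<close> al by (intro fp(1)[of y "\<alpha>0" x]) (auto simp: x_def)
      also have "\<dots> \<le> h (s - \<alpha>) + h \<alpha>"
      proof (cases "s - \<alpha> \<le> p")
        case True
        then have "y = p" by (simp add: y_def)
        then show ?thesis
          using c(1)[of "s - \<alpha>" p] c(2)[of x \<alpha>] True x p al y by (simp add: x_def algebra_simps)
      next
        case False
        then show ?thesis by (simp add: y_def x_def)
      qed
      finally show ?thesis by simp
    qed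
  qed
  then show False using test[OF a0] by simp
qed

end

section \<open>Integrals of concave functions of distribution functions\<close>

lemma integrable_bounded_support:
  fixes f :: "real \<Rightarrow> real"
  assumes [measurable]: "f \<in> borel_measurable borel" and b: "\<And>x. \<bar>f x\<bar> \<le> K" and z: "\<And>x. x \<notin> {l..r} \<Longrightarrow> f x = 0"
  shows "integrable lborel f"
proof (rule Bochner_Integration.integrable_bound)
  show "integrable lborel (\<lambda>x. K * indicator {l..r} x)"
    by (cases "l \<le> r") auto
  show "AE x in lborel. norm (f x) \<le> norm (K * indicator {l..r} x)"
  proof (rule AE_I2)
    fix x
    show "norm (f x) \<le> norm (K * indicator {l..r} x)"
      using b[of x] z[of x] by (cases "x \<in> {l..r}") auto
  qed
qed simp

text \<open>Strict on the left and weak on the right, as holds for \<open>P (X \<le> x)\<close> when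
  \<open>\<bar>X\<bar> \<le> R\<close>.\<close>

definition cdf_within :: "real \<Rightarrow> (real \<Rightarrow> real) \<Rightarrow> bool" where
  "cdf_within R u \<longleftrightarrow> mono u \<and> (\<forall>x. u x \<in> {0..1}) \<and> (\<forall>x. x < - R \<longrightarrow> u x = 0) \<and> (\<forall>x. R \<le> x \<longrightarrow> u x = 1)"

lemma integrable_diff_cdf:
  fixes f :: "real \<Rightarrow> real"
  assumes u: "cdf_within R u" and v: "cdf_within R v" and f: "mono_on {0..1} f"
  shows "integrable lborel (\<lambda>x. f (u x) - f (v x))"
proof (rule integrable_bounded_support[where l = "-R" and r = R and K = "f 1 - f 0"])
  have "mono (\<lambda>x. f (u x))" if "cdf_within R u" for u
    using that f by (auto simp: cdf_within_def mono_def mono_on_def)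
  then have "(\<lambda>x. f (u x)) \<in> borel_measurable borel" "(\<lambda>x. f (v x)) \<in> borel_measurable borel"
    using u v borel_measurable_mono by blast+
  then show "(\<lambda>x. f (u x) - f (v x)) \<in> borel_measurable borel" by simp
  show "\<bar>f (u x) - f (v x)\<bar> \<le> f 1 - f 0" for x
  proof -
    have "f 0 \<le> f y \<and> f y \<le> f 1" if "y \<in> {0..1}" for y using f that by (auto simp: mono_on_def)
    then show ?thesis using u v unfolding cdf_within_def by (smt (verit))
  qed
  show "f (u x) - f (v x) = 0" if "x \<notin> {-R..R}" for x
    using that u v by (auto simp: cdf_within_def not_le)
qed

text \<open>The sum plus \<open>g (w 0)\<close> is the piecewise linear interpolant of
  \<open>g\<close>, because \<open>min s (w (Suc i)) - min s (w i)\<close> is the length of the part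
  of the \<open>i\<close>-th cell below \<open>s\<close>. At \<open>s\<close>, interpolant and
  \<open>g\<close> lie between the same two nodal values, which differ by at most
  \<open>e\<close>.\<close>

lemma piecewise_linear_approximation:
  fixes g :: "real \<Rightarrow> real"
  assumes g: "mono_on {w 0..w n} g" and w: "\<And>i. w (Suc i) = w i + \<delta>" "\<delta> > 0"
    and inc: "\<And>i. i < n \<Longrightarrow> g (w (Suc i)) - g (w i) \<le> e" and e: "0 \<le> e"
    and s: "s \<in> {w 0..w n}"
  shows "\<bar>(\<Sum>i<n. (g (w (Suc i)) - g (w i)) / \<delta> * (min s (w (Suc i)) - min s (w i))) + g (w 0) - g s\<bar> \<le> e"
proof -
  have wm: "i \<le> j \<Longrightarrow> w i \<le> w j" for i j
    by (rule lift_Suc_mono_le[of w]) (use w in auto)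
  define P where "P m = (\<Sum>i<m. (g (w (Suc i)) - g (w i)) / \<delta> * (min s (w (Suc i)) - min s (w i)))" for m
  \<comment> \<open>Cells to the left of \<open>s\<close> telescope and cells to its right add
    nothing, so the error arises only in the cell of \<open>s\<close>.\<close>
  have "m \<le> n \<Longrightarrow> (w m \<le> s \<longrightarrow> P m = g (w m) - g (w 0)) \<and> (s \<le> w m \<longrightarrow> \<bar>P m + g (w 0) - g s\<bar> \<le> e)" for m
  proof (induction m)
    case 0
    then show ?case using s e by (auto simp: P_def)
  next
    case (Suc m)
    have PS: "P (Suc m) = P m + (g (w (Suc m)) - g (w m)) / \<delta> * (min s (w (Suc m)) - min s (w m))"
      by (simp add: P_def)
    have mem: "w m \<in> {w 0..w n}" "w (Suc m) \<in> {w 0..w n}" using wm Suc.prems by auto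
    then have g0: "0 \<le> g (w (Suc m)) - g (w m)" using g w by (auto simp: mono_on_def)
    consider "w (Suc m) \<le> s" | "s < w (Suc m)" "w m \<le> s" | "s < w m" by linarith
    then show ?case
    proof cases
      case 1
      then have "w m \<le> s" using w by (smt (verit))
      then have "P (Suc m) = g (w (Suc m)) - g (w 0)" using PS Suc 1 w by simp
      moreover have "s \<le> w (Suc m) \<longrightarrow> s = w (Suc m)" using 1 by simp
      ultimately show ?thesis using e by auto
    next
      case 2
      define l where "l = (s - w m) / \<delta>"
      have l: "0 \<le> l" "l \<le> 1" using 2 w by (auto simp: l_def field_simps)
      have "P (Suc m) = g (w m) - g (w 0) + (g (w (Suc m)) - g (w m)) * l"
        using PS Suc 2 by (simp add: l_def)
      moreover have "0 \<le> (g (w (Suc m)) - g (w m)) * l" using g0 l by simp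
      moreover have "(g (w (Suc m)) - g (w m)) * l \<le> g (w (Suc m)) - g (w m)"
        using g0 l by (simp add: mult_left_le)
      moreover have "g (w m) \<le> g s" "g s \<le> g (w (Suc m))"
        using g mem s 2 by (auto simp: mono_on_def)
      moreover have "g (w (Suc m)) - g (w m) \<le> e" using inc Suc.prems by simp
      ultimately show ?thesis using 2 by auto
    next
      case 3
      then have "s < w (Suc m)" using w by (smt (verit))
      then show ?thesis using PS Suc 3 by simp
    qed
  qed
  from this[of n] show ?thesis using s by (simp add: P_def)
qed

text \<open>Summation by parts: for positive \<open>n\<close> the sum is
  \<open>\<rho> (n - 1) * D n\<close> plus the nonnegative terms
  \<open>(\<rho> (i - 1) - \<rho> i) * D i\<close>.\<close>

lemma abel_sum_nonneg:
  fixes \<rho> D :: "nat \<Rightarrow> real"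
  assumes "\<And>i. i < n \<Longrightarrow> 0 \<le> \<rho> i" "\<And>i. Suc i < n \<Longrightarrow> \<rho> (Suc i) \<le> \<rho> i"
    and D: "\<And>i. i \<le> n \<Longrightarrow> 0 \<le> D i" "D 0 = 0"
  shows "0 \<le> (\<Sum>i<n. \<rho> i * (D (Suc i) - D i))"
proof -
  have "m < n \<Longrightarrow> \<rho> m * D m \<le> (\<Sum>i<m. \<rho> i * (D (Suc i) - D i))" for m
  proof (induction m)
    case (Suc m)
    have "\<rho> (Suc m) * D (Suc m) \<le> \<rho> m * D (Suc m)"
      using assms Suc.prems by (intro mult_right_mono) auto
    then show ?case using Suc by (simp add: algebra_simps)
  qed (use D in simp)
  note this[of "n - 1"]
  moreover have "0 \<le> \<rho> (n - 1) * D n" if "0 < n" using assms that by (intro mult_nonneg_nonneg) auto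
  ultimately show ?thesis by (cases n) (auto simp: algebra_simps)
qed

text \<open>The interpolant of \<open>g\<close> has nonnegative decreasing slopes, so summation by
  parts reduces its integral to the differences in \<open>J\<close>; the mesh then tends to 0.
  Clamping the argument extends \<open>g\<close> by constants outside \<open>{a..b}\<close>.\<close>

lemma integral_diff_cdf_concave_nonneg:
  fixes g :: "real \<Rightarrow> real"
  assumes u: "cdf_within R u" and v: "cdf_within R v"
    and ab: "0 \<le> a" "a < b" "b \<le> 1"
    and g: "mono_on {a..b} g" "continuous_on {a..b} g" "concave_on {a..b} g"
    and J: "\<And>w. w \<in> {a..b} \<Longrightarrow>
      (\<integral>x. min (u x) a - min (v x) a \<partial>lborel) \<le> (\<integral>x. min (u x) w - min (v x) w \<partial>lborel)"
  shows "0 \<le> (\<integral>x. g (max a (min (u x) b)) - g (max a (min (v x) b)) \<partial>lborel)"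
proof -
  define I where "I f = (\<integral>x. f (u x) - f (v x) \<partial>lborel)" for f :: "real \<Rightarrow> real"
  define G where "G t = g (max a (min t b))" for t
  have G: "mono_on {0..1} G"
    using g(1) ab by (auto simp: G_def mono_on_def)
  have R: "0 \<le> R"
  proof (rule ccontr)
    assume "\<not> 0 \<le> R"
    then have "u (R / 2) = 0" "u (R / 2) = 1" using u by (auto simp: cdf_within_def)
    then show False by simp
  qed
  have approx: "- (4 * R * e) \<le> I G" if e: "0 < e" for e
  proof -
    have "uniformly_continuous_on {a..b} g"
      using g(2) by (simp add: compact_uniformly_continuous)
    then obtain d where d: "d > 0" "\<And>x y. x \<in> {a..b} \<Longrightarrow> y \<in> {a..b} \<Longrightarrow> dist y x < d \<Longrightarrow> dist (g y) (g x) < e"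
      unfolding uniformly_continuous_on_def using e by metis
    obtain n :: nat where n: "(b - a) / d < n" using reals_Archimedean2 by blast
    have "0 < (b - a) / d" using ab d by simp
    then have n0: "0 < n" using n by (cases n) auto
    define \<delta> where "\<delta> = (b - a) / n"
    have \<delta>: "0 < \<delta>" "\<delta> < d" using n n0 ab d by (auto simp: \<delta>_def field_simps)
    define w where "w i = a + real i * \<delta>" for i
    have w: "w 0 = a" "w n = b" "\<And>i. w (Suc i) = w i + \<delta>"
      using n0 by (auto simp: w_def \<delta>_def distrib_right add_divide_distrib)
    have wm: "i \<le> j \<Longrightarrow> w i \<le> w j" for i j
      using \<delta> by (simp add: w_def)
    have wmem: "i \<le> n \<Longrightarrow> w i \<in> {a..b}" for i using wm[of 0 i] wm[of i n] w by simp
    define \<rho> where "\<rho> i = (g (w (Suc i)) - g (w i)) / \<delta>" for i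
    have inc: "g (w (Suc i)) - g (w i) \<le> e" if "i < n" for i
      using d(2)[of "w i" "w (Suc i)"] wmem[of i] wmem[of "Suc i"] that w \<delta> by (simp add: dist_real_def)
    define f where "f t = (\<Sum>i<n. \<rho> i * (min t (w (Suc i)) - min t (w i)))" for t
    have "0 \<le> \<rho> i" if "i < n" for i
      using g(1) wmem[of i] wmem[of "Suc i"] that w \<delta> by (auto simp: \<rho>_def mono_on_def)
    have close: "\<bar>f t + g a - G t\<bar> \<le> e" for t
    proof -
      define s where "s = max a (min t b)"
      consider "t < a" "s = a" | "b < t" "s = b" | "s = t"
        using ab by (cases "t < a"; cases "b < t") (simp_all add: s_def)
      then have "min t (w (Suc i)) - min t (w i) = min s (w (Suc i)) - min s (w i)" if "i < n" for i
        using wmem[of i] wmem[of "Suc i"] that by cases (simp_all add: min_absorb1 min_absorb2)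
      then have "f t = f s" unfolding f_def by (intro sum.cong) auto
      moreover have "s \<in> {w 0..w n}" using ab by (auto simp: s_def w)
      ultimately show ?thesis
        using piecewise_linear_approximation[of w n g \<delta> e s] g(1) w \<delta>(1) inc e
        unfolding f_def \<rho>_def G_def s_def[symmetric] by auto
    qed
    have im: "integrable lborel (\<lambda>x. min (u x) z - min (v x) z)" for z
      by (rule integrable_diff_cdf[OF u v]) (auto simp: mono_on_def)
    define D where "D i = I (\<lambda>t. min t (w i)) - I (\<lambda>t. min t a)" for i
    have fdiff: "f (u x) - f (v x) = (\<Sum>i<n. \<rho> i * ((min (u x) (w (Suc i)) - min (v x) (w (Suc i))) - (min (u x) (w i) - min (v x) (w i))))" for x
      unfolding f_def sum_subtractf[symmetric] by (intro sum.cong) (auto simp: algebra_simps)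
    have fint: "integrable lborel (\<lambda>x. f (u x) - f (v x))"
      unfolding fdiff using im by (intro Bochner_Integration.integrable_sum integrable_mult_right) auto
    have "I f = (\<Sum>i<n. \<rho> i * (D (Suc i) - D i))"
      unfolding I_def fdiff using im by (simp add: D_def I_def)
    also have "0 \<le> \<dots>"
    proof (rule abel_sum_nonneg)
      show "\<And>i. i < n \<Longrightarrow> 0 \<le> \<rho> i" by fact
      show "\<rho> (Suc i) \<le> \<rho> i" if "Suc i < n" for i
      proof -
        have "convex_on {a..b} (\<lambda>x. - g x)" using g(3) by (simp add: concave_on_def)
        from convex_onD[OF this, of "1/2" "w i" "w (Suc (Suc i))"]
        have "g (w i) + g (w (Suc (Suc i))) \<le> 2 * g ((1 - 1/2) *\<^sub>R w i + (1/2) *\<^sub>R w (Suc (Suc i)))"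
          using wmem[of i] wmem[of "Suc (Suc i)"] that by simp
        moreover have "(1 - 1/2) *\<^sub>R w i + (1/2) *\<^sub>R w (Suc (Suc i)) = w (Suc i)"
          by (simp add: w(3) field_simps)
        ultimately have "g (w i) + g (w (Suc (Suc i))) \<le> 2 * g (w (Suc i))" by simp
        then show ?thesis using \<delta> by (simp add: \<rho>_def divide_right_mono)
      qed
      show "0 \<le> D i" if "i \<le> n" for i using J[OF wmem[OF that]] by (simp add: D_def I_def)
      show "D 0 = 0" by (simp add: D_def w)
    qed
    finally have "0 \<le> I f" .
    \<comment> \<open>Each of the two terms is off by at most \<open>e\<close>, and outside
      \<open>{-R..R}\<close> the functions \<open>u\<close> and \<open>v\<close> agree; hence the
      total error \<open>4 * R * e\<close>.\<close>
    also have "I f \<le> (\<integral>x. (G (u x) - G (v x)) + 2 * e * indicator {-R..R} x \<partial>lborel)"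
      unfolding I_def
    proof (rule integral_mono)
      show "integrable lborel (\<lambda>x. f (u x) - f (v x))" by (rule fint)
      show "integrable lborel (\<lambda>x. (G (u x) - G (v x)) + 2 * e * indicator {-R..R} x)"
        using integrable_diff_cdf[OF u v G] R by auto
      fix x
      show "f (u x) - f (v x) \<le> (G (u x) - G (v x)) + 2 * e * indicator {-R..R} x"
      proof (cases "x \<in> {-R..R}")
        case True
        then show ?thesis using close[of "u x"] close[of "v x"] by (simp add: abs_le_iff)
      next
        case False
        then have "u x = v x" using u v by (auto simp: cdf_within_def not_le)
        then show ?thesis using False by simp
      qed
    qed
    also have "\<dots> = I G + 4 * R * e"
      using integrable_diff_cdf[OF u v G] R by (simp add: I_def)
    finally show ?thesis by simp
  qed
  have "0 \<le> I G"
  proof (rule field_le_epsilon)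
    fix e :: real assume "0 < e"
    \<comment> \<open>The denominator is positive also for \<open>R = 0\<close>.\<close>
    then have "- (4 * R * (e / (4 * R + 1))) \<le> I G" using R by (intro approx) simp
    moreover have "4 * R * (e / (4 * R + 1)) \<le> e" using R \<open>0 < e\<close> by (simp add: field_simps)
    ultimately show "0 \<le> I G + e" by simp
  qed
  then show ?thesis by (simp add: I_def G_def)
qed

text \<open>\<open>f1\<close> on \<open>{0..q}\<close> and \<open>f2\<close> on
  \<open>{q..1}\<close> are nondecreasing and concave, and \<open>k\<close> is their clamped
  difference plus an affine function. As \<open>f2\<close> enters with a minus sign,
  \<open>u\<close> and \<open>v\<close> change places there, which matches the direction of
  \<open>J2\<close>; \<open>J3\<close> removes the affine part.\<close>

lemma integral_diff_cdf_nonneg: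
  fixes k :: "real \<Rightarrow> real"
  assumes u: "cdf_within R u" and v: "cdf_within R v" and q: "0 < q" "q < 1"
    and k: "mono_on {0..1} k" "continuous_on {0..1} k" "concave_on {0..q} k" "convex_on {q..1} k"
    and c1: "\<And>x y. 0 \<le> x \<Longrightarrow> x \<le> y \<Longrightarrow> y \<le> q \<Longrightarrow> c * (y - x) \<le> k y - k x"
    and c2: "\<And>x y. q \<le> x \<Longrightarrow> x \<le> y \<Longrightarrow> y \<le> 1 \<Longrightarrow> k y - k x \<le> c * (y - x)"
    and J1: "\<And>w. w \<in> {0..q} \<Longrightarrow> 0 \<le> (\<integral>x. min (u x) w - min (v x) w \<partial>lborel)"
    and J2: "\<And>w. w \<in> {q..1} \<Longrightarrow>
      (\<integral>x. min (u x) w - min (v x) w \<partial>lborel) \<le> (\<integral>x. min (u x) q - min (v x) q \<partial>lborel)"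
    and J3: "(\<integral>x. u x - v x \<partial>lborel) = 0"
  shows "0 \<le> (\<integral>x. k (u x) - k (v x) \<partial>lborel)"
proof -
  define f1 where "f1 t = k t - c * t" for t
  define f2 where "f2 t = c * t - k t" for t
  have u01: "u x \<in> {0..1}" and v01: "v x \<in> {0..1}" for x using u v by (auto simp: cdf_within_def)
  have sub: "continuous_on {0..q} k" "continuous_on {q..1} k"
    using k(2) q by (auto elim: continuous_on_subset)
  have m1: "mono_on {0..q} f1" using c1 by (auto simp: mono_on_def f1_def algebra_simps)
  have m2: "mono_on {q..1} f2" using c2 by (auto simp: mono_on_def f2_def algebra_simps)
  have l: "concave_on {0..q} f1" "concave_on {q..1} f2"
    using k(3,4) unfolding concave_on_def convex_on_def f1_def f2_def real_scaleR_def
    by (auto simp: algebra_simps)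
  have n1: "0 \<le> (\<integral>x. f1 (max 0 (min (u x) q)) - f1 (max 0 (min (v x) q)) \<partial>lborel)"
  proof (rule integral_diff_cdf_concave_nonneg[OF u v _ _ _ m1 _ l(1)])
    show "continuous_on {0..q} f1" unfolding f1_def by (intro continuous_intros sub)
    have "min (u x) 0 = 0" "min (v x) 0 = 0" for x using u01[of x] v01[of x] by auto
    then show "(\<integral>x. min (u x) 0 - min (v x) 0 \<partial>lborel) \<le> (\<integral>x. min (u x) w - min (v x) w \<partial>lborel)" if "w \<in> {0..q}" for w
      using J1[OF that] by simp
  qed (use q in auto)
  have n2: "0 \<le> (\<integral>x. f2 (max q (min (v x) 1)) - f2 (max q (min (u x) 1)) \<partial>lborel)"
  proof (rule integral_diff_cdf_concave_nonneg[OF v u _ _ _ m2 _ l(2)])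
    show "continuous_on {q..1} f2" unfolding f2_def by (intro continuous_intros sub)
    have sw: "(\<integral>x. min (v x) w - min (u x) w \<partial>lborel) = - (\<integral>x. min (u x) w - min (v x) w \<partial>lborel)" for w
      by (subst Bochner_Integration.integral_minus[symmetric]) simp
    show "(\<integral>x. min (v x) q - min (u x) q \<partial>lborel) \<le> (\<integral>x. min (v x) w - min (u x) w \<partial>lborel)" if "w \<in> {q..1}" for w
      using J2[OF that] unfolding sw by simp
  qed (use q in auto)
  have "k t = f1 (max 0 (min t q)) - f2 (max q (min t 1)) + c * t - (k q - c * q)" if "t \<in> {0..1}" for t
    using that q by (cases "t \<le> q") (simp_all add: f1_def f2_def)
  note split = this[OF u01] this[OF v01]
  have decomp: "k (u x) - k (v x) = (f1 (max 0 (min (u x) q)) - f1 (max 0 (min (v x) q)))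
      + (f2 (max q (min (v x) 1)) - f2 (max q (min (u x) 1))) + c * (u x - v x)" for x
    unfolding split[of x] by (simp add: right_diff_distrib)
  have i1: "integrable lborel (\<lambda>x. f1 (max 0 (min (u x) q)) - f1 (max 0 (min (v x) q)))"
    by (rule integrable_diff_cdf[OF u v]) (use m1 q in \<open>auto simp: mono_on_def\<close>)
  have i2: "integrable lborel (\<lambda>x. f2 (max q (min (v x) 1)) - f2 (max q (min (u x) 1)))"
    by (rule integrable_diff_cdf[OF v u]) (use m2 q in \<open>auto simp: mono_on_def\<close>)
  have i3: "integrable lborel (\<lambda>x. u x - v x)"
    by (rule integrable_diff_cdf[OF u v]) (auto simp: mono_on_def)
  show ?thesis unfolding decomp using n1 n2 i1 i2 i3 J3 by simp
qed

section \<open>Lower expected shortfall\<close>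

text \<open>The signed length of the interval from 0 to \<open>d\<close>; it serves to move the
  normalisation of \<open>shortfall\<close> from 0 to \<open>d\<close>.\<close>

lemma integral_indicator_diff:
  fixes d :: real
  shows "integrable lborel (\<lambda>x. indicator {0..} x - indicator {d<..} x :: real)"
    and "(\<integral>x. indicator {0..} x - indicator {d<..} x \<partial>lborel) = d"
proof -
  have "(\<lambda>x. indicator {0..} x - indicator {d<..} x :: real) =
      (if 0 \<le> d then indicator {0..d} else (\<lambda>x. - indicator {d<..<0} x))"
    by (auto simp: indicator_def fun_eq_iff)
  then show "integrable lborel (\<lambda>x. indicator {0..} x - indicator {d<..} x :: real)"
    "(\<integral>x. indicator {0..} x - indicator {d<..} x \<partial>lborel) = d"
    by auto
qed

context prob_space
begin

definition rv_cdf :: "('a \<Rightarrow> real) \<Rightarrow> real \<Rightarrow> real" where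
  "rv_cdf X x = \<P>(\<omega> in M. X \<omega> \<le> x)"

lemma bounded_rvsE:
  assumes "X \<in> bounded_rvs M"
  obtains R where "0 < R" "\<And>\<omega>. \<omega> \<in> space M \<Longrightarrow> \<bar>X \<omega>\<bar> \<le> R" "X \<in> borel_measurable M"
proof -
  obtain R where "\<forall>x\<in>X ` space M. norm x \<le> R"
    using assms by (auto simp: bounded_rvs_def bounded_iff)
  then have "\<And>\<omega>. \<omega> \<in> space M \<Longrightarrow> \<bar>X \<omega>\<bar> \<le> max R 1" by fastforce
  moreover have "X \<in> borel_measurable M" using assms by (simp add: bounded_rvs_def)
  ultimately show ?thesis using that[of "max R 1"] by simp
qed

lemma bounded_rvs_add:
  assumes "X \<in> bounded_rvs M" "Y \<in> bounded_rvs M"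
  shows "(\<lambda>\<omega>. X \<omega> + Y \<omega>) \<in> bounded_rvs M"
  using assms by (auto simp: bounded_rvs_def intro!: bounded_plus_comp)

lemma cdf_within_rv_cdf:
  assumes "X \<in> borel_measurable M" "\<And>\<omega>. \<omega> \<in> space M \<Longrightarrow> \<bar>X \<omega>\<bar> \<le> R"
  shows "cdf_within R (rv_cdf X)"
  unfolding cdf_within_def
proof (intro conjI allI impI)
  note [measurable] = assms(1)
  show "mono (rv_cdf X)"
    by (auto simp: rv_cdf_def intro!: monoI finite_measure_mono)
  show "rv_cdf X x = 0" if "x < - R" for x
  proof -
    have e: "{\<omega>\<in>space M. X \<omega> \<le> x} = {}" using assms(2) that by (force simp: abs_le_iff)
    show ?thesis unfolding rv_cdf_def e by simp
  qed
  show "rv_cdf X x = 1" if "R \<le> x" for x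
  proof -
    have e: "{\<omega>\<in>space M. X \<omega> \<le> x} = space M" using assms(2) that by (force simp: abs_le_iff)
    show ?thesis unfolding rv_cdf_def e by (rule prob_space)
  qed
qed (simp add: rv_cdf_def)

lemma rv_cdf_props:
  assumes "X \<in> bounded_rvs M"
  shows "mono (rv_cdf X)" "rv_cdf X \<in> borel_measurable borel" "0 \<le> rv_cdf X x" "rv_cdf X x \<le> 1"
proof -
  obtain R where "cdf_within R (rv_cdf X)" using bounded_rvsE[OF assms] cdf_within_rv_cdf by metis
  then show "mono (rv_cdf X)" "0 \<le> rv_cdf X x" "rv_cdf X x \<le> 1" by (auto simp: cdf_within_def)
  then show "rv_cdf X \<in> borel_measurable borel" by (simp add: borel_measurable_mono)
qed

lemma rv_cdf_right_continuous:
  assumes [measurable]: "X \<in> borel_measurable M" and "\<And>x. a < x \<Longrightarrow> w \<le> rv_cdf X x"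
  shows "w \<le> rv_cdf X a"
proof -
  interpret D: real_distribution "distr M borel X" by (rule real_distribution_distr) simp
  have eq: "rv_cdf X = cdf (distr M borel X)"
    by (auto simp: rv_cdf_def cdf_def measure_distr fun_eq_iff vimage_def Int_def conj_commute)
  have "(rv_cdf X \<longlongrightarrow> rv_cdf X a) (at_right a)"
    using D.cdf_is_right_cont[of a] by (simp add: eq continuous_within)
  moreover have "\<forall>\<^sub>F x in at_right a. w \<le> rv_cdf X x"
    by (rule eventually_at_rightI[of a "a + 1"]) (use assms(2) in auto)
  ultimately show ?thesis by (rule tendsto_lowerbound) simp
qed

text \<open>These conditions make \<open>min (rv_cdf X x) w\<close> equal to
  \<open>rv_cdf X x\<close> to the left of \<open>a\<close> and to \<open>w\<close> from
  \<open>a\<close> on. Such an \<open>a\<close> need not be unique.\<close>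

definition is_quantile :: "real \<Rightarrow> ('a \<Rightarrow> real) \<Rightarrow> real \<Rightarrow> bool" where
  "is_quantile w X a \<longleftrightarrow> (\<forall>x<a. rv_cdf X x \<le> w) \<and> (\<forall>x\<ge>a. w \<le> rv_cdf X x)"

lemma ex_quantile:
  assumes "X \<in> bounded_rvs M" "0 \<le> w" "w \<le> 1"
  obtains a where "is_quantile w X a"
proof -
  obtain R where R: "0 < R" "cdf_within R (rv_cdf X)" and [measurable]: "X \<in> borel_measurable M"
    using bounded_rvsE[OF assms(1)] cdf_within_rv_cdf by metis
  have c: "\<And>x. x < - R \<Longrightarrow> rv_cdf X x = 0" "rv_cdf X R = 1" "\<And>x y. x \<le> y \<Longrightarrow> rv_cdf X x \<le> rv_cdf X y"
    using R(2) unfolding cdf_within_def by (blast, blast, blast dest: monoD)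
  \<comment> \<open>The bound \<open>- R\<close> keeps \<open>S\<close> bounded below also for
    \<open>w = 0\<close>.\<close>
  define S where "S = {x. - R \<le> x \<and> w \<le> rv_cdf X x}"
  have RS: "R \<in> S" using c(2) assms R(1) by (simp add: S_def)
  have bdd: "bdd_below S" by (auto simp: S_def intro: bdd_belowI[of _ "- R"])
  have 1: "rv_cdf X x \<le> w" if "x < Inf S" for x
  proof (cases "x < - R")
    case False
    have "x \<notin> S" using cInf_lower[OF _ bdd, of x] that by auto
    then show ?thesis using False by (simp add: S_def)
  next
    case True
    then show ?thesis using c(1) assms by simp
  qed
  have 2: "w \<le> rv_cdf X x" if "Inf S < x" for x
  proof -
    have "S \<noteq> {}" using RS by auto
    from cInf_lessD[OF this that] obtain s where "s \<in> S" "s < x" by auto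
    moreover from \<open>s < x\<close> have "rv_cdf X s \<le> rv_cdf X x" using c(3) by simp
    ultimately show ?thesis by (simp add: S_def)
  qed
  have 3: "w \<le> rv_cdf X (Inf S)" by (rule rv_cdf_right_continuous[OF _ 2]) simp
  have "w \<le> rv_cdf X x" if "Inf S \<le> x" for x
    using 2[of x] 3 that by (cases "x = Inf S") simp_all
  with 1 have "is_quantile w X (Inf S)" by (simp add: is_quantile_def)
  then show ?thesis by (rule that)
qed

text \<open>Fubini: the positive part of \<open>d - X - Y\<close> is the length of the interval from
  \<open>X\<close> to \<open>d - Y\<close>, the set of \<open>x\<close> with
  \<open>X \<le> x\<close> and \<open>Y \<le> d - x\<close>. The weight allows the identity to be
  applied to part of the mass.\<close>

lemma expectation_positive_part_sum:
  fixes d :: real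
  assumes X: "X \<in> bounded_rvs M" and Y: "Y \<in> bounded_rvs M"
    and [measurable]: "\<phi> \<in> borel_measurable M" and \<phi>: "\<And>\<omega>. \<omega> \<in> space M \<Longrightarrow> 0 \<le> \<phi> \<omega> \<and> \<phi> \<omega> \<le> 1"
  defines "g \<equiv> (\<lambda>x. expectation (\<lambda>\<omega>. \<phi> \<omega> * indicator {\<omega>\<in>space M. X \<omega> \<le> x \<and> Y \<omega> \<le> d - x} \<omega>))"
  shows "integrable lborel g"
    and "expectation (\<lambda>\<omega>. \<phi> \<omega> * max 0 (d - (X \<omega> + Y \<omega>))) = (\<integral>x. g x \<partial>lborel)"
proof -
  interpret P: pair_sigma_finite lborel M ..
  obtain A where A: "0 < A" "\<And>\<omega>. \<omega> \<in> space M \<Longrightarrow> \<bar>X \<omega>\<bar> \<le> A" and [measurable]: "X \<in> borel_measurable M"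
    by (rule bounded_rvsE[OF X]) auto
  obtain B where B: "0 < B" "\<And>\<omega>. \<omega> \<in> space M \<Longrightarrow> \<bar>Y \<omega>\<bar> \<le> B" and [measurable]: "Y \<in> borel_measurable M"
    by (rule bounded_rvsE[OF Y]) auto
  define R where "R = A + B + \<bar>d\<bar>"
  define f where "f = (\<lambda>(x::real) \<omega>. \<phi> \<omega> * (if X \<omega> \<le> x \<and> Y \<omega> \<le> d - x then 1 else 0))"
  have int: "integrable (lborel \<Otimes>\<^sub>M M) (case_prod f)"
  proof (rule Bochner_Integration.integrable_bound)
    show "integrable (lborel \<Otimes>\<^sub>M M) (indicator ({- R..R} \<times> space M) :: real \<times> 'a \<Rightarrow> real)"
      using A B by (intro integrable_real_indicator)
        (auto simp: emeasure_pair_measure_Times emeasure_space_1 R_def ennreal_mult_less_top)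
    show "case_prod f \<in> borel_measurable (lborel \<Otimes>\<^sub>M M)"
      unfolding f_def by measurable
    show "AE z in lborel \<Otimes>\<^sub>M M. norm (case_prod f z) \<le> norm (indicator ({- R..R} \<times> space M) z :: real)"
    proof (rule AE_I2)
      fix z :: "real \<times> 'a" assume z: "z \<in> space (lborel \<Otimes>\<^sub>M M)"
      obtain x \<omega> where zz: "z = (x, \<omega>)" by (cases z)
      then have \<omega>: "\<omega> \<in> space M" using z by (auto simp: space_pair_measure)
      have "X \<omega> \<le> x \<and> Y \<omega> \<le> d - x \<Longrightarrow> x \<in> {- R..R}"
        using A(1) A(2)[OF \<omega>] B(1) B(2)[OF \<omega>] by (auto simp: R_def abs_le_iff)
      then show "norm (case_prod f z) \<le> norm (indicator ({- R..R} \<times> space M) z :: real)"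
        using \<phi>[OF \<omega>] \<omega> by (auto simp: zz f_def)
    qed
  qed
  have gf: "g x = (\<integral>\<omega>. f x \<omega> \<partial>M)" for x
    unfolding g_def f_def by (intro Bochner_Integration.integral_cong) (auto simp: indicator_def)
  show "integrable lborel g" unfolding gf using P.integrable_fst'[OF int] by simp
  have "(\<integral>\<omega>. (\<integral>x. f x \<omega> \<partial>lborel) \<partial>M) = (\<integral>x. g x \<partial>lborel)"
    unfolding gf by (rule P.Fubini_integral[OF int])
  moreover have "(\<integral>x. f x \<omega> \<partial>lborel) = \<phi> \<omega> * max 0 (d - (X \<omega> + Y \<omega>))" for \<omega>
  proof -
    have "f x \<omega> = \<phi> \<omega> * indicator {X \<omega>..d - Y \<omega>} x" for x by (auto simp: f_def indicator_def)
    then have "(\<integral>x. f x \<omega> \<partial>lborel) = \<phi> \<omega> * measure lborel {X \<omega>..d - Y \<omega>}" by simp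
    also have "measure lborel {X \<omega>..d - Y \<omega>} = max 0 (d - (X \<omega> + Y \<omega>))"
      by (cases "X \<omega> \<le> d - Y \<omega>") simp_all
    finally show ?thesis .
  qed
  ultimately show "expectation (\<lambda>\<omega>. \<phi> \<omega> * max 0 (d - (X \<omega> + Y \<omega>))) = (\<integral>x. g x \<partial>lborel)" by simp
qed

lemma expectation_positive_part_sum':
  assumes X: "X \<in> bounded_rvs M" and Y: "Y \<in> bounded_rvs M"
  shows "integrable lborel (\<lambda>x. \<P>(\<omega> in M. X \<omega> \<le> x \<and> Y \<omega> \<le> d - x))"
    and "expectation (\<lambda>\<omega>. max 0 (d - (X \<omega> + Y \<omega>))) = (\<integral>x. \<P>(\<omega> in M. X \<omega> \<le> x \<and> Y \<omega> \<le> d - x) \<partial>lborel)"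
  using expectation_positive_part_sum[OF X Y, of "\<lambda>_. 1" d] by (auto simp: Int_absorb2)

lemma expectation_positive_part:
  assumes X: "X \<in> bounded_rvs M"
  shows "integrable lborel (\<lambda>x. rv_cdf X x * indicator {..d} x)"
    and "expectation (\<lambda>\<omega>. max 0 (d - X \<omega>)) = (\<integral>x. rv_cdf X x * indicator {..d} x \<partial>lborel)"
proof -
  have "(\<lambda>_. 0) \<in> bounded_rvs M" by (auto simp: bounded_rvs_def intro: boundedI[where B = 0])
  note * = expectation_positive_part_sum'[OF X this, of d]
  have "\<P>(\<omega> in M. X \<omega> \<le> x \<and> 0 \<le> d - x) = rv_cdf X x * indicator {..d} x" for x
    by (auto simp: rv_cdf_def indicator_def)
  then show "integrable lborel (\<lambda>x. rv_cdf X x * indicator {..d} x)"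
    "expectation (\<lambda>\<omega>. max 0 (d - X \<omega>)) = (\<integral>x. rv_cdf X x * indicator {..d} x \<partial>lborel)"
    using * by simp_all
qed

text \<open>In terms of the quantile function \<open>Q\<close> of \<open>X\<close>, this is \<open>- \<integral>\<^sub>0\<^sup>w Q\<close>.\<close>

definition shortfall :: "real \<Rightarrow> ('a \<Rightarrow> real) \<Rightarrow> real" where
  "shortfall w X = (\<integral>x. min (rv_cdf X x) w - w * indicator {0..} x \<partial>lborel)"

lemma integrable_shortfall:
  assumes X: "X \<in> bounded_rvs M" and w: "0 \<le> w" "w \<le> 1"
  shows "integrable lborel (\<lambda>x. min (rv_cdf X x) w - w * indicator {0..} x)"
proof -
  obtain R where R: "0 < R" "cdf_within R (rv_cdf X)"
    using bounded_rvsE[OF X] cdf_within_rv_cdf by metis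
  note [measurable] = rv_cdf_props(2)[OF X]
  show ?thesis
  proof (rule integrable_bounded_support[where l = "-R" and r = R and K = 1])
    show "\<bar>min (rv_cdf X x) w - w * indicator {0..} x\<bar> \<le> 1" for x
      using rv_cdf_props(3,4)[OF X, of x] w by (auto simp: indicator_def abs_le_iff)
    show "min (rv_cdf X x) w - w * indicator {0..} x = 0" if "x \<notin> {- R..R}" for x
      using that R w by (cases "x < - R") (auto simp: cdf_within_def)
  qed simp
qed

text \<open>Both parts together say that the shortfall is the minimum over \<open>d\<close> of the right-hand side.\<close>

lemma shortfall_le:
  assumes X: "X \<in> bounded_rvs M" and w: "0 \<le> w" "w \<le> 1"
  shows "shortfall w X \<le> expectation (\<lambda>\<omega>. max 0 (d - X \<omega>)) - w * d"
    and "is_quantile w X d \<Longrightarrow> shortfall w X = expectation (\<lambda>\<omega>. max 0 (d - X \<omega>)) - w * d"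
proof -
  note p = expectation_positive_part[OF X, of d] and i = integral_indicator_diff[of d]
  \<comment> \<open>Apart from the normalisation, \<open>?g\<close> is \<open>rv_cdf X\<close> up to
    \<open>d\<close> and \<open>w\<close> beyond. This dominates \<open>min (rv_cdf X x) w\<close>,
    with equality off \<open>d\<close> if \<open>d\<close> is a quantile.\<close>
  let ?g = "\<lambda>x. rv_cdf X x * indicator {..d} x - w * (indicator {0..} x - indicator {d<..} x)"
  have gi: "integrable lborel ?g" using p i by (intro Bochner_Integration.integrable_diff) auto
  have g: "(\<integral>x. ?g x \<partial>lborel) = expectation (\<lambda>\<omega>. max 0 (d - X \<omega>)) - w * d"
    using p i by (subst Bochner_Integration.integral_diff) auto
  show "shortfall w X \<le> expectation (\<lambda>\<omega>. max 0 (d - X \<omega>)) - w * d"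
    unfolding g[symmetric] shortfall_def
    by (rule integral_mono[OF integrable_shortfall[OF assms] gi]) (auto simp: indicator_def)
  assume q: "is_quantile w X d"
  show "shortfall w X = expectation (\<lambda>\<omega>. max 0 (d - X \<omega>)) - w * d"
    unfolding g[symmetric] shortfall_def
  proof (rule Bochner_Integration.integral_cong_AE)
    show "AE x in lborel. min (rv_cdf X x) w - w * indicator {0..} x = ?g x"
      using AE_lborel_singleton[of d]
    proof eventually_elim
      fix x assume "x \<noteq> d"
      then show "min (rv_cdf X x) w - w * indicator {0..} x = ?g x"
        using q by (cases "x < d") (auto simp: is_quantile_def indicator_def)
    qed
    show "?g \<in> borel_measurable lborel" using gi by auto
    show "(\<lambda>x. min (rv_cdf X x) w - w * indicator {0..} x) \<in> borel_measurable lborel"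
      using integrable_shortfall[OF assms] by auto
  qed
qed

lemma integrable_bounded_rv:
  assumes "X \<in> bounded_rvs M" and f: "continuous_on UNIV (f :: real \<Rightarrow> real)"
    and [measurable]: "\<phi> \<in> borel_measurable M" and \<phi>: "\<And>\<omega>. \<omega> \<in> space M \<Longrightarrow> 0 \<le> \<phi> \<omega> \<and> \<phi> \<omega> \<le> (1::real)"
  shows "integrable M (\<lambda>\<omega>. \<phi> \<omega> * f (X \<omega>))" "integrable M (\<lambda>\<omega>. f (X \<omega>))"
proof -
  obtain R where R: "0 < R" "\<And>\<omega>. \<omega> \<in> space M \<Longrightarrow> \<bar>X \<omega>\<bar> \<le> R" and [measurable]: "X \<in> borel_measurable M"
    by (rule bounded_rvsE[OF assms(1)]) auto
  note [measurable] = borel_measurable_continuous_onI[OF f]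
  have "bounded (f ` {-R..R})"
    using f by (intro compact_imp_bounded compact_continuous_image) (auto elim: continuous_on_subset)
  then obtain K where K: "\<And>x. x \<in> {-R..R} \<Longrightarrow> \<bar>f x\<bar> \<le> K"
    unfolding bounded_iff by (metis image_eqI real_norm_def)
  have b: "\<bar>f (X \<omega>)\<bar> \<le> K" if "\<omega> \<in> space M" for \<omega> using R(2)[OF that] K by (auto simp: abs_le_iff)
  show i: "integrable M (\<lambda>\<omega>. f (X \<omega>))"
    by (rule integrable_const_bound[of _ K]) (use b in auto)
  show "integrable M (\<lambda>\<omega>. \<phi> \<omega> * f (X \<omega>))"
  proof (rule Bochner_Integration.integrable_bound[OF i])
    show "AE \<omega> in M. norm (\<phi> \<omega> * f (X \<omega>)) \<le> norm (f (X \<omega>))"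
      using \<phi> by (intro AE_I2) (simp add: abs_mult mult_left_le_one_le)
  qed simp
qed

text \<open>The weight selects the lower part of \<open>X\<close> of mass exactly \<open>w\<close>:
  all of \<open>X < a\<close> and a fraction \<open>\<theta>\<close> of the event that
  \<open>X\<close> equals the quantile \<open>a\<close>.\<close>

lemma shortfall_weight:
  assumes X: "X \<in> bounded_rvs M" and w: "0 \<le> w" "w \<le> 1"
  obtains \<psi> where "\<psi> \<in> borel_measurable M" "\<And>\<omega>. \<omega> \<in> space M \<Longrightarrow> 0 \<le> \<psi> \<omega> \<and> \<psi> \<omega> \<le> 1"
    "expectation \<psi> = w" "expectation (\<lambda>\<omega>. \<psi> \<omega> * X \<omega>) = - shortfall w X"
proof -
  obtain a where a: "is_quantile w X a" using ex_quantile[OF assms] .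
  obtain R where R: "0 < R" "\<And>\<omega>. \<omega> \<in> space M \<Longrightarrow> \<bar>X \<omega>\<bar> \<le> R" and [measurable]: "X \<in> borel_measurable M"
    by (rule bounded_rvsE[OF X]) auto
  define L where "L = {\<omega>\<in>space M. X \<omega> < a}"
  define E where "E = {\<omega>\<in>space M. X \<omega> = a}"
  have [measurable]: "L \<in> events" "E \<in> events" by (auto simp: L_def E_def)
  \<comment> \<open>As an increasing union, \<open>L\<close> has as its probability the left limit
    of the distribution function at \<open>a\<close>, which is at most \<open>w\<close>.\<close>
  have "L = (\<Union>n. {\<omega>\<in>space M. X \<omega> \<le> a - 1 / Suc n})"
  proof -
    have "\<exists>n. x \<le> a - 1 / Suc n" if "x < a" for x
      using reals_Archimedean[of "a - x"] that by (auto simp: inverse_eq_divide intro!: less_imp_le)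
        (smt (verit))
    moreover have "x < a" if "x \<le> a - 1 / Suc n" for x n
      using that by (smt (verit) of_nat_0_less_iff zero_less_Suc zero_less_divide_1_iff)
    ultimately show ?thesis unfolding L_def by blast
  qed
  moreover have "(\<lambda>n. prob {\<omega>\<in>space M. X \<omega> \<le> a - 1 / Suc n}) \<longlonglongrightarrow> prob (\<Union>n. {\<omega>\<in>space M. X \<omega> \<le> a - 1 / Suc n})"
  proof (rule finite_Lim_measure_incseq)
    show "incseq (\<lambda>n. {\<omega>\<in>space M. X \<omega> \<le> a - 1 / Suc n})"
      by (rule incseq_SucI) (auto intro: order_trans simp: frac_le)
  qed auto
  ultimately have lim: "(\<lambda>n. rv_cdf X (a - 1 / Suc n)) \<longlonglongrightarrow> prob L" by (simp add: rv_cdf_def)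
  have L: "prob L \<le> w"
    by (rule LIMSEQ_le_const2[OF lim]) (use a in \<open>auto simp: is_quantile_def\<close>)
  have "L \<union> E = {\<omega>\<in>space M. X \<omega> \<le> a}" by (auto simp: L_def E_def)
  moreover have "prob (L \<union> E) = prob L + prob E" by (rule finite_measure_Union) (auto simp: L_def E_def)
  ultimately have E: "w \<le> prob L + prob E" using a by (auto simp: is_quantile_def rv_cdf_def)
  \<comment> \<open>If \<open>prob E = 0\<close> the quotient is 0, and the two bounds force
    \<open>prob L = w\<close>.\<close>
  define \<theta> where "\<theta> = (w - prob L) / prob E"
  have \<theta>: "0 \<le> \<theta>" "\<theta> \<le> 1" "\<theta> * prob E = w - prob L"
    using L E by (auto simp: \<theta>_def divide_simps)
  define \<psi> where "\<psi> \<omega> = indicator L \<omega> + \<theta> * indicator E \<omega>" for \<omega>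
  show ?thesis
  proof
    show [measurable]: "\<psi> \<in> borel_measurable M" unfolding \<psi>_def by measurable
    show b: "0 \<le> \<psi> \<omega> \<and> \<psi> \<omega> \<le> 1" if "\<omega> \<in> space M" for \<omega>
      using \<theta> by (auto simp: \<psi>_def indicator_def L_def E_def)
    show e: "expectation \<psi> = w"
      unfolding \<psi>_def using \<theta> by (simp add: emeasure_eq_measure)
    have p: "\<psi> \<omega> * (X \<omega> - a) = - max 0 (a - X \<omega>)" if "\<omega> \<in> space M" for \<omega>
      using that by (cases "X \<omega>" a rule: linorder_cases) (auto simp: \<psi>_def L_def E_def)
    have i: "integrable M (\<lambda>\<omega>. \<psi> \<omega> * X \<omega>)" "integrable M \<psi>"
      using integrable_bounded_rv(1)[OF X, of "\<lambda>x. x" \<psi>] integrable_bounded_rv(1)[OF X, of "\<lambda>x. 1" \<psi>] b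
      by (auto intro: continuous_intros)
    have "expectation (\<lambda>\<omega>. \<psi> \<omega> * X \<omega>) - a * w = expectation (\<lambda>\<omega>. \<psi> \<omega> * X \<omega> - a * \<psi> \<omega>)"
      using i e by simp
    also have "\<dots> = expectation (\<lambda>\<omega>. - max 0 (a - X \<omega>))"
      using p by (intro Bochner_Integration.integral_cong) (auto simp: algebra_simps)
    finally show "expectation (\<lambda>\<omega>. \<psi> \<omega> * X \<omega>) = - shortfall w X"
      using shortfall_le(2)[OF assms a] by (simp add: algebra_simps)
  qed
qed

end

section \<open>Sums under the copula\<close>

lemma lborel_reflect:
  fixes f :: "real \<Rightarrow> real"
  assumes "integrable lborel f"
  shows "integrable lborel (\<lambda>x. f (d - x))" "(\<integral>x. f (d - x) \<partial>lborel) = (\<integral>x. f x \<partial>lborel)"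
  using lborel_integrable_real_affine[OF assms, of "-1" d] lborel_integral_real_affine[of "-1" f d]
  by simp_all

text \<open>The tail kernel is the smallest possible value of
  \<open>P (D \<inter> {X \<le> x, Y \<le> y})\<close> for an event \<open>D\<close> of probability \<open>1 - q\<close>, given
  \<open>u = P (X \<le> x)\<close> and \<open>v = P (Y \<le> y)\<close>; it is attained by the countermonotone part of \<open>C_pm\<close>.\<close>

definition tail_kernel :: "real \<Rightarrow> real \<Rightarrow> real \<Rightarrow> real" where
  "tail_kernel q u v = max 0 (max 0 (u - q) + max 0 (v - q) - (1 - q))"

text \<open>Mass \<open>1 - p\<close> at the bottom is comonotone and gives the capped minimum; the
  remaining mass \<open>p\<close> is countermonotone.\<close>

lemma C_pm_eq_tail_kernel:
  assumes "0 < p" "p < 1" "u \<in> {0..1}" "v \<in> {0..1}"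
  shows "C_pm p u v = tail_kernel (1 - p) u v + min (min u v) (1 - p)"
  using assms unfolding C_pm_def tail_kernel_def by (auto simp: min_def max_def)

context prob_space
begin

text \<open>The shortfall is a minimum over thresholds; for the sum the threshold
  \<open>a + b\<close> is tried, and the positive part is subadditive.\<close>

lemma shortfall_add_le:
  assumes X: "X \<in> bounded_rvs M" and Y: "Y \<in> bounded_rvs M" and w: "0 \<le> w" "w \<le> 1"
  shows "shortfall w (\<lambda>\<omega>. X \<omega> + Y \<omega>) \<le> shortfall w X + shortfall w Y"
proof -
  obtain a where a: "is_quantile w X a" using ex_quantile[OF X w] .
  obtain b where b: "is_quantile w Y b" using ex_quantile[OF Y w] .
  have i: "integrable M (\<lambda>\<omega>. max 0 (e - V \<omega>))" if "V \<in> bounded_rvs M" for V e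
    by (rule integrable_bounded_rv(2)[OF that, of "\<lambda>x. max 0 (e - x)" "\<lambda>_. 1"]) (auto intro!: continuous_intros)
  have "shortfall w (\<lambda>\<omega>. X \<omega> + Y \<omega>) \<le> expectation (\<lambda>\<omega>. max 0 (a + b - (X \<omega> + Y \<omega>))) - w * (a + b)"
    by (rule shortfall_le(1)[OF bounded_rvs_add[OF X Y] w])
  also have "expectation (\<lambda>\<omega>. max 0 (a + b - (X \<omega> + Y \<omega>))) \<le> expectation (\<lambda>\<omega>. max 0 (a - X \<omega>) + max 0 (b - Y \<omega>))"
    using i[OF X] i[OF Y] i[OF bounded_rvs_add[OF X Y]]
    by (intro integral_mono Bochner_Integration.integrable_add) auto
  also have "\<dots> = expectation (\<lambda>\<omega>. max 0 (a - X \<omega>)) + expectation (\<lambda>\<omega>. max 0 (b - Y \<omega>))"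
    using i X Y by (intro Bochner_Integration.integral_add)
  finally show ?thesis
    using shortfall_le(2)[OF X w a] shortfall_le(2)[OF Y w b] by (simp add: algebra_simps)
qed

text \<open>The integrand is that of \<open>shortfall w X\<close> plus the reflected one of
  \<open>shortfall w Y\<close>; the two normalisations leave \<open>w\<close> times the signed
  length of the interval from 0 to \<open>d\<close>.\<close>

lemma integral_min_sum:
  assumes X: "X \<in> bounded_rvs M" and Y: "Y \<in> bounded_rvs M" and w: "0 \<le> w" "w \<le> 1"
  shows "integrable lborel (\<lambda>x. min (rv_cdf X x) w + min (rv_cdf Y (d - x)) w - w)"
    and "(\<integral>x. min (rv_cdf X x) w + min (rv_cdf Y (d - x)) w - w \<partial>lborel)
      = shortfall w X + shortfall w Y + w * d"
proof -
  note i = integral_indicator_diff[of d] integrable_shortfall[OF X w] lborel_reflect[OF integrable_shortfall[OF Y w], of d]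
  have eq: "min (rv_cdf X x) w + min (rv_cdf Y (d - x)) w - w =
     (min (rv_cdf X x) w - w * indicator {0..} x) + (min (rv_cdf Y (d - x)) w - w * indicator {0..} (d - x))
      + w * (indicator {0..} x - indicator {d<..} x)" for x
    by (auto simp: indicator_def)
  show "integrable lborel (\<lambda>x. min (rv_cdf X x) w + min (rv_cdf Y (d - x)) w - w)"
    unfolding eq using i by (intro Bochner_Integration.integrable_add integrable_mult_right) auto
  show "(\<integral>x. min (rv_cdf X x) w + min (rv_cdf Y (d - x)) w - w \<partial>lborel)
      = shortfall w X + shortfall w Y + w * d"
    unfolding eq using i
    by (subst Bochner_Integration.integral_add, (intro Bochner_Integration.integrable_add integrable_mult_right; simp), (intro integrable_mult_right; simp))+
       (simp add: shortfall_def)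
qed

text \<open>At a quantile \<open>d\<close> of the sum, \<open>shortfall\<close> plus
  \<open>w * d\<close> is exactly the integral of the joint distribution function along
  \<open>x + y = d\<close>, and \<open>min (min u v) w\<close> is at least
  \<open>min u w + min v w - w\<close>.\<close>

lemma shortfall_add_ge:
  assumes X: "X \<in> bounded_rvs M" and Y: "Y \<in> bounded_rvs M" and w: "0 \<le> w" "w \<le> 1"
    and joint: "\<And>x y. min (min (rv_cdf X x) (rv_cdf Y y)) w \<le> \<P>(\<omega> in M. X \<omega> \<le> x \<and> Y \<omega> \<le> y)"
  shows "shortfall w X + shortfall w Y \<le> shortfall w (\<lambda>\<omega>. X \<omega> + Y \<omega>)"
proof -
  obtain d where d: "is_quantile w (\<lambda>\<omega>. X \<omega> + Y \<omega>) d"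
    using ex_quantile[OF bounded_rvs_add[OF X Y] w] .
  note s = expectation_positive_part_sum'[OF X Y, of d] and i = integral_min_sum[OF X Y w, of d]
  have "shortfall w X + shortfall w Y + w * d = (\<integral>x. min (rv_cdf X x) w + min (rv_cdf Y (d - x)) w - w \<partial>lborel)"
    by (simp add: i)
  also have "\<dots> \<le> (\<integral>x. \<P>(\<omega> in M. X \<omega> \<le> x \<and> Y \<omega> \<le> d - x) \<partial>lborel)"
  proof (rule integral_mono[OF i(1) s(1)])
    show "min (rv_cdf X x) w + min (rv_cdf Y (d - x)) w - w \<le> \<P>(\<omega> in M. X \<omega> \<le> x \<and> Y \<omega> \<le> d - x)" for x
      using joint[of x "d - x"] by linarith
  qed
  also have "\<dots> = shortfall w (\<lambda>\<omega>. X \<omega> + Y \<omega>) + w * d"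
    using shortfall_le(2)[OF bounded_rvs_add[OF X Y] w d] s(2) by simp
  finally show ?thesis by simp
qed

lemma integrable_tail_kernel:
  assumes X: "X \<in> bounded_rvs M" and Y: "Y \<in> bounded_rvs M" and q: "0 \<le> q" "q \<le> 1"
  shows "integrable lborel (\<lambda>x. tail_kernel q (rv_cdf X x) (rv_cdf Y (d - x)))"
proof -
  obtain A where A: "cdf_within A (rv_cdf X)" using bounded_rvsE[OF X] cdf_within_rv_cdf by metis
  obtain B where B: "cdf_within B (rv_cdf Y)" using bounded_rvsE[OF Y] cdf_within_rv_cdf by metis
  note [measurable] = rv_cdf_props(2)[OF X] rv_cdf_props(2)[OF Y]
  note F = rv_cdf_props(3,4)[OF X] and G = rv_cdf_props(3,4)[OF Y]
  show ?thesis
  proof (rule integrable_bounded_support[where l = "- A" and r = "d + B" and K = 1])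
    show "(\<lambda>x. tail_kernel q (rv_cdf X x) (rv_cdf Y (d - x))) \<in> borel_measurable borel"
      unfolding tail_kernel_def by measurable
    show "\<bar>tail_kernel q (rv_cdf X x) (rv_cdf Y (d - x))\<bar> \<le> 1" for x
      using F[of x] G[of "d - x"] q unfolding tail_kernel_def by linarith
    show "tail_kernel q (rv_cdf X x) (rv_cdf Y (d - x)) = 0" if "x \<notin> {- A..d + B}" for x
    proof -
      have "rv_cdf X x = 0 \<or> rv_cdf Y (d - x) = 0" using that A B by (auto simp: cdf_within_def)
      then show ?thesis using F[of x] G[of "d - x"] q unfolding tail_kernel_def by linarith
    qed
  qed
qed

text \<open>The weight \<open>\<phi>\<close> selects the upper part of \<open>X + Y\<close> of mass \<open>1 - q\<close>; restricted to it, the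
  joint distribution function obeys the Frechet lower bound.\<close>

lemma shortfall_diff_ge:
  assumes X: "X \<in> bounded_rvs M" and Y: "Y \<in> bounded_rvs M" and q: "0 \<le> q" "q \<le> w" "w \<le> 1"
  obtains d where "(\<integral>x. tail_kernel q (rv_cdf X x) (rv_cdf Y (d - x)) \<partial>lborel) - (w - q) * d
    \<le> shortfall w (\<lambda>\<omega>. X \<omega> + Y \<omega>) - shortfall q (\<lambda>\<omega>. X \<omega> + Y \<omega>)"
proof -
  define Z where "Z = (\<lambda>\<omega>. X \<omega> + Y \<omega>)"
  have Z: "Z \<in> bounded_rvs M" unfolding Z_def by (rule bounded_rvs_add[OF X Y])
  have w: "0 \<le> w" and q1: "q \<le> 1" using q by auto
  obtain d where d: "is_quantile w Z d" using ex_quantile[OF Z w q(3)] .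
  obtain \<psi> where [measurable]: "\<psi> \<in> borel_measurable M" and \<psi>: "\<And>\<omega>. \<omega> \<in> space M \<Longrightarrow> 0 \<le> \<psi> \<omega> \<and> \<psi> \<omega> \<le> 1"
    and e: "expectation \<psi> = q" "expectation (\<lambda>\<omega>. \<psi> \<omega> * Z \<omega>) = - shortfall q Z"
    using shortfall_weight[OF Z q(1) q1] by metis
  have [measurable]: "X \<in> borel_measurable M" "Y \<in> borel_measurable M" using X Y by (auto simp: bounded_rvs_def)
  define \<phi> where "\<phi> = (\<lambda>\<omega>. 1 - \<psi> \<omega>)"
  have [measurable]: "\<phi> \<in> borel_measurable M" unfolding \<phi>_def by measurable
  have \<phi>: "\<And>\<omega>. \<omega> \<in> space M \<Longrightarrow> 0 \<le> \<phi> \<omega> \<and> \<phi> \<omega> \<le> 1" using \<psi> by (auto simp: \<phi>_def)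
  have i\<psi>: "integrable M \<psi>" and i\<phi>: "integrable M \<phi>"
    by (rule integrable_const_bound[of _ 1]; use \<psi> \<phi> in auto)+
  have e\<phi>: "expectation \<phi> = 1 - q" using e i\<psi> by (simp add: \<phi>_def prob_space)
  have ind: "integrable M (\<lambda>\<omega>. \<phi> \<omega> * indicator A \<omega>)" if "A \<in> events" for A
    using that i\<phi> by (rule integrable_mult_indicator[where 'b = real, unfolded real_scaleR_def, THEN Bochner_Integration.integrable_cong[THEN iffD1, rotated -1]]) (auto simp: mult.commute)
  \<comment> \<open>At most mass \<open>q\<close> of \<open>A\<close> is lost to
    \<open>\<psi>\<close>.\<close>
  have single: "max 0 (prob A - q) \<le> expectation (\<lambda>\<omega>. \<phi> \<omega> * indicator A \<omega>)" if A[measurable]: "A \<in> events" for A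
  proof -
    have "0 \<le> expectation (\<lambda>\<omega>. \<phi> \<omega> * indicator A \<omega>)"
      using \<phi> by (intro integral_nonneg_AE AE_I2) auto
    moreover have "prob A - q = expectation (\<lambda>\<omega>. indicator A \<omega> - \<psi> \<omega>)"
      using i\<psi> e by (simp add: emeasure_eq_measure)
    moreover have "\<dots> \<le> expectation (\<lambda>\<omega>. \<phi> \<omega> * indicator A \<omega>)"
    proof (rule integral_mono)
      show "integrable M (\<lambda>\<omega>. indicator A \<omega> - \<psi> \<omega>)" using i\<psi> by (simp add: emeasure_eq_measure)
      show "indicator A \<omega> - \<psi> \<omega> \<le> \<phi> \<omega> * indicator A \<omega>" if "\<omega> \<in> space M" for \<omega>
        using \<psi>[OF that] by (simp add: \<phi>_def indicator_def)
    qed (rule ind[OF A])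
    ultimately show ?thesis by simp
  qed
  have joint: "tail_kernel q (rv_cdf X x) (rv_cdf Y y)
      \<le> expectation (\<lambda>\<omega>. \<phi> \<omega> * indicator {\<omega>\<in>space M. X \<omega> \<le> x \<and> Y \<omega> \<le> y} \<omega>)" for x y
  proof -
    let ?A = "{\<omega>\<in>space M. X \<omega> \<le> x}" and ?B = "{\<omega>\<in>space M. Y \<omega> \<le> y}" and ?S = "{\<omega>\<in>space M. X \<omega> \<le> x \<and> Y \<omega> \<le> y}"
    have ev: "?A \<in> events" "?B \<in> events" "?S \<in> events" by measurable
    have "expectation (\<lambda>\<omega>. \<phi> \<omega> * indicator ?A \<omega>) + expectation (\<lambda>\<omega>. \<phi> \<omega> * indicator ?B \<omega>) - (1 - q)
        = expectation (\<lambda>\<omega>. \<phi> \<omega> * indicator ?A \<omega> + \<phi> \<omega> * indicator ?B \<omega> - \<phi> \<omega>)"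
      using ind[OF ev(1)] ind[OF ev(2)] i\<phi> e\<phi> by simp
    also have "\<dots> \<le> expectation (\<lambda>\<omega>. \<phi> \<omega> * indicator ?S \<omega>)"
      using ind[OF ev(1)] ind[OF ev(2)] ind[OF ev(3)] i\<phi> \<phi> by (intro integral_mono) (auto simp: indicator_def)
    finally show ?thesis
      using single[OF ev(1)] single[OF ev(2)] single[OF ev(3)]
      unfolding tail_kernel_def rv_cdf_def by linarith
  qed
  have cont: "continuous_on UNIV (\<lambda>x. max 0 (d - x))" by (intro continuous_intros)
  have iZ: "integrable M (\<lambda>\<omega>. \<eta> \<omega> * max 0 (d - Z \<omega>))" "integrable M (\<lambda>\<omega>. max 0 (d - Z \<omega>))" "integrable M (\<lambda>\<omega>. \<eta> \<omega> * Z \<omega>)"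
    if "\<eta> \<in> borel_measurable M" "\<And>\<omega>. \<omega> \<in> space M \<Longrightarrow> 0 \<le> \<eta> \<omega> \<and> \<eta> \<omega> \<le> 1" for \<eta>
    by (rule integrable_bounded_rv[OF Z cont that] integrable_bounded_rv(1)[OF Z _ that, of "\<lambda>x. x"];
        simp add: continuous_on_id)+
  have "(\<integral>x. tail_kernel q (rv_cdf X x) (rv_cdf Y (d - x)) \<partial>lborel) \<le> expectation (\<lambda>\<omega>. \<phi> \<omega> * max 0 (d - Z \<omega>))"
    unfolding Z_def using expectation_positive_part_sum[where d = d, OF X Y _ \<phi>] integrable_tail_kernel[OF X Y q(1) q1, of d] joint
    by (auto intro!: integral_mono)
  \<comment> \<open>The lower part contributes at least the expectation of
    \<open>\<psi> \<omega> * (d - Z \<omega>)\<close>, which is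
    \<open>q * d + shortfall q Z\<close>.\<close>
  moreover have "expectation (\<lambda>\<omega>. \<phi> \<omega> * max 0 (d - Z \<omega>)) + (q * d + shortfall q Z)
      = expectation (\<lambda>\<omega>. \<phi> \<omega> * max 0 (d - Z \<omega>) + (d * \<psi> \<omega> - \<psi> \<omega> * Z \<omega>))"
    using iZ(1)[of \<phi>] iZ(3)[of \<psi>] \<phi> \<psi> i\<psi> e by simp
  moreover have "\<dots> \<le> expectation (\<lambda>\<omega>. max 0 (d - Z \<omega>))"
  proof (rule integral_mono)
    fix \<omega> assume "\<omega> \<in> space M"
    then have "\<psi> \<omega> * (d - Z \<omega>) \<le> \<psi> \<omega> * max 0 (d - Z \<omega>)" using \<psi> by (intro mult_left_mono) auto
    then show "\<phi> \<omega> * max 0 (d - Z \<omega>) + (d * \<psi> \<omega> - \<psi> \<omega> * Z \<omega>) \<le> max 0 (d - Z \<omega>)"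
      by (simp add: \<phi>_def algebra_simps)
  qed (use iZ(1)[of \<phi>] iZ(2,3)[of \<psi>] \<phi> \<psi> i\<psi> in auto)
  ultimately have "(\<integral>x. tail_kernel q (rv_cdf X x) (rv_cdf Y (d - x)) \<partial>lborel) - (w - q) * d
    \<le> shortfall w Z - shortfall q Z"
    using shortfall_le(2)[OF Z w q(3) d] by (simp add: algebra_simps)
  then show ?thesis using that unfolding Z_def by blast
qed

text \<open>For a threshold \<open>e \<ge> a + b\<close>, each \<open>x\<close> has
  \<open>a \<le> x\<close> or \<open>b \<le> e - x\<close>, so the comonotone part is exactly
  \<open>min u q + min v q - q\<close> and integrates to the shortfalls of \<open>X\<close> and
  \<open>Y\<close>. A smaller \<open>d\<close> is compared with \<open>a + b\<close>, where the
  kernel integral \<open>K\<close> vanishes.\<close>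

lemma shortfall_diff_le:
  assumes X: "X \<in> bounded_rvs M" and Y: "Y \<in> bounded_rvs M" and q: "0 \<le> q" "q \<le> w" "w \<le> 1"
    and joint: "\<And>x y. \<P>(\<omega> in M. X \<omega> \<le> x \<and> Y \<omega> \<le> y)
      = tail_kernel q (rv_cdf X x) (rv_cdf Y y) + min (min (rv_cdf X x) (rv_cdf Y y)) q"
  shows "shortfall w (\<lambda>\<omega>. X \<omega> + Y \<omega>) - shortfall q (\<lambda>\<omega>. X \<omega> + Y \<omega>)
    \<le> (\<integral>x. tail_kernel q (rv_cdf X x) (rv_cdf Y (d - x)) \<partial>lborel) - (w - q) * d"
proof -
  define K where "K d = (\<integral>x. tail_kernel q (rv_cdf X x) (rv_cdf Y (d - x)) \<partial>lborel)" for d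
  define Z where "Z = (\<lambda>\<omega>. X \<omega> + Y \<omega>)"
  have Z: "Z \<in> bounded_rvs M" unfolding Z_def by (rule bounded_rvs_add[OF X Y])
  have w: "0 \<le> w" and q1: "q \<le> 1" using q by auto
  note F = rv_cdf_props(3,4)[OF X] and G = rv_cdf_props(3,4)[OF Y]
  obtain a where a: "is_quantile q X a" using ex_quantile[OF X q(1) q1] .
  obtain b where b: "is_quantile q Y b" using ex_quantile[OF Y q(1) q1] .
  have tk: "0 \<le> tail_kernel q u v" for u v by (simp add: tail_kernel_def)
  have large: "shortfall w Z - shortfall q Z \<le> K e - (w - q) * e" if "a + b \<le> e" for e
  proof -
    note k = integrable_tail_kernel[OF X Y q(1) q1, of e] and m = integral_min_sum[OF X Y q(1) q1, of e]
    have "\<P>(\<omega> in M. X \<omega> \<le> x \<and> Y \<omega> \<le> e - x)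
      = tail_kernel q (rv_cdf X x) (rv_cdf Y (e - x)) + (min (rv_cdf X x) q + min (rv_cdf Y (e - x)) q - q)" for x
    proof -
      have "a \<le> x \<or> b \<le> e - x" using that by linarith
      then have "q \<le> rv_cdf X x \<or> q \<le> rv_cdf Y (e - x)" using a b by (auto simp: is_quantile_def)
      then show ?thesis unfolding joint by linarith
    qed
    then have "expectation (\<lambda>\<omega>. max 0 (e - Z \<omega>)) = K e + (shortfall q X + shortfall q Y + q * e)"
      using expectation_positive_part_sum'(2)[OF X Y, of e] k m by (simp add: Z_def K_def)
    moreover have "shortfall q X + shortfall q Y \<le> shortfall q Z"
      unfolding Z_def by (rule shortfall_add_ge[OF X Y q(1) q1]) (simp add: joint tk)
    ultimately show ?thesis using shortfall_le(1)[OF Z w q(3), of e] by (simp add: algebra_simps)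
  qed
  have K0: "0 \<le> K e" for e unfolding K_def using tk by (intro integral_nonneg_AE AE_I2) auto
  have Kab: "K (a + b) = 0"
  proof -
    have "AE x in lborel. tail_kernel q (rv_cdf X x) (rv_cdf Y (a + b - x)) = 0"
      using AE_lborel_singleton[of a]
    proof eventually_elim
      fix x assume "x \<noteq> a"
      then have "x < a \<or> a + b - x < b" by linarith
      then have "rv_cdf X x \<le> q \<or> rv_cdf Y (a + b - x) \<le> q" using a b by (auto simp: is_quantile_def)
      then show "tail_kernel q (rv_cdf X x) (rv_cdf Y (a + b - x)) = 0"
        using F[of x] G[of "a + b - x"] q1 unfolding tail_kernel_def by linarith
    qed
    then show ?thesis unfolding K_def by (rule integral_eq_zero_AE)
  qed
  have "shortfall w Z - shortfall q Z \<le> K d - (w - q) * d"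
  proof (cases "a + b \<le> d")
    case False
    then have "(w - q) * d \<le> (w - q) * (a + b)" using q by (intro mult_left_mono) auto
    then show ?thesis using large[of "a + b"] Kab K0[of d] by simp
  qed (rule large)
  then show ?thesis by (simp add: K_def Z_def)
qed

section \<open>Sufficiency of the copula and slope conditions\<close>

lemma shortfall_1:
  assumes X: "X \<in> bounded_rvs M"
  shows "shortfall 1 X = - expectation X" "integrable M X"
proof -
  obtain R where R: "0 < R" "\<And>\<omega>. \<omega> \<in> space M \<Longrightarrow> \<bar>X \<omega>\<bar> \<le> R" and [measurable]: "X \<in> borel_measurable M"
    by (rule bounded_rvsE[OF X]) auto
  show i: "integrable M X" by (rule integrable_const_bound[of _ R]) (use R in auto)
  have q: "is_quantile 1 X R"
    using cdf_within_rv_cdf[OF _ R(2)] by (auto simp: is_quantile_def cdf_within_def)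
  have "expectation (\<lambda>\<omega>. max 0 (R - X \<omega>)) = expectation (\<lambda>\<omega>. R - X \<omega>)"
    using R by (intro Bochner_Integration.integral_cong) (auto simp: abs_le_iff)
  then show "shortfall 1 X = - expectation X"
    using shortfall_le(2)[OF X _ _ q] i by (simp add: prob_space)
qed

text \<open>The two integrals of the definition merge into that of
  \<open>h (1 - rv_cdf V x) - indicator {..<0} x\<close>, and the indicator cancels in the
  difference.\<close>

lemma distorted_expectation_diff:
  assumes h: "distortion h" and X: "X \<in> bounded_rvs M" and Y: "Y \<in> bounded_rvs M"
  shows "distorted_expectation M h Y - distorted_expectation M h X
    = (\<integral>x. h (1 - rv_cdf Y x) - h (1 - rv_cdf X x) \<partial>lborel)"
proof -
  have h01: "h 0 = 0" "h 1 = 1" and hm: "mono_on {0..1} h" using h by (auto simp: distortion_def)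
  have rep: "integrable lborel (\<lambda>x. h (1 - rv_cdf V x) - indicator {..<0} x) \<and>
    distorted_expectation M h V = (\<integral>x. h (1 - rv_cdf V x) - indicator {..<0} x \<partial>lborel)" if V: "V \<in> bounded_rvs M" for V
  proof -
    obtain R where R: "0 < R" "cdf_within R (rv_cdf V)" and [measurable]: "V \<in> borel_measurable M"
      using bounded_rvsE[OF V] cdf_within_rv_cdf by metis
    have c: "\<And>x. x < - R \<Longrightarrow> rv_cdf V x = 0" "\<And>x. R \<le> x \<Longrightarrow> rv_cdf V x = 1"
      using R(2) by (simp_all add: cdf_within_def)
    have surv: "\<P>(\<omega> in M. V \<omega> > x) = 1 - rv_cdf V x" for x
    proof -
      have "{\<omega>\<in>space M. V \<omega> > x} = space M - {\<omega>\<in>space M. V \<omega> \<le> x}" by auto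
      then show ?thesis by (simp add: prob_compl rv_cdf_def)
    qed
    have "mono (\<lambda>x. - h (1 - rv_cdf V x))"
      using hm rv_cdf_props(1,3,4)[OF V] by (auto simp: mono_def mono_on_def)
    then have "(\<lambda>x. - (- h (1 - rv_cdf V x))) \<in> borel_measurable borel"
      by (intro borel_measurable_uminus borel_measurable_mono)
    then have [measurable]: "(\<lambda>x. h (1 - rv_cdf V x)) \<in> borel_measurable borel" by simp
    have hb: "\<bar>h (1 - rv_cdf V x)\<bar> \<le> 1" "\<bar>h (1 - rv_cdf V x) - 1\<bar> \<le> 1" for x
    proof -
      have "h (1 - rv_cdf V x) \<in> {0..1}" using h rv_cdf_props(3,4)[OF V, of x]
        by (simp add: distortion_def image_subset_iff)
      then show "\<bar>h (1 - rv_cdf V x)\<bar> \<le> 1" "\<bar>h (1 - rv_cdf V x) - 1\<bar> \<le> 1" by auto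
    qed
    have i1: "integrable lborel (\<lambda>x. indicator {0..} x *\<^sub>R h (1 - rv_cdf V x))"
      by (rule integrable_bounded_support[where l = "- R" and r = R and K = 1])
        (use hb c h01 R in \<open>auto simp: indicator_def not_le\<close>)
    have i2: "integrable lborel (\<lambda>x. indicator {..0} x *\<^sub>R (h (1 - rv_cdf V x) - 1))"
      by (rule integrable_bounded_support[where l = "- R" and r = R and K = 1])
        (use hb c h01 R in \<open>auto simp: indicator_def not_le\<close>)
    define g where "g = (\<lambda>x. indicator {0..} x *\<^sub>R h (1 - rv_cdf V x) + indicator {..0} x *\<^sub>R (h (1 - rv_cdf V x) - 1))"
    have ig: "integrable lborel g" unfolding g_def using i1 i2 by simp
    have "distorted_expectation M h V = (\<integral>x. g x \<partial>lborel)"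
      unfolding distorted_expectation_def set_lebesgue_integral_def surv g_def using i1 i2 by simp
    moreover have ae: "AE x in lborel. g x = h (1 - rv_cdf V x) - indicator {..<0} x"
      using AE_lborel_singleton[of 0] by eventually_elim (auto simp: g_def indicator_def)
    moreover have "(\<lambda>x. h (1 - rv_cdf V x) - indicator {..<0} x) \<in> borel_measurable lborel" by simp
    ultimately show ?thesis
      using ig integral_cong_AE[OF _ _ ae] integrable_cong_AE[OF _ _ ae] by (auto simp: borel_measurable_integrable)
  qed
  have "(\<integral>x. h (1 - rv_cdf Y x) - h (1 - rv_cdf X x) \<partial>lborel)
    = (\<integral>x. (h (1 - rv_cdf Y x) - indicator {..<0} x) - (h (1 - rv_cdf X x) - indicator {..<0} x) \<partial>lborel)"
    by simp
  also have "\<dots> = distorted_expectation M h Y - distorted_expectation M h X"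
    using rep[OF X] rep[OF Y] by (subst Bochner_Integration.integral_diff) auto
  finally show ?thesis by simp
qed

lemma C_pm_imp_universally_optimal:
  assumes iss: "ISS h p" and rd: "right_deriv h 0 \<le> right_deriv h p"
    and C: "\<And>u v. u \<in> {0..1} \<Longrightarrow> v \<in> {0..1} \<Longrightarrow> C u v = C_pm p u v"
  shows "universally_optimal M h C"
  unfolding universally_optimal_def
proof (intro ballI impI)
  fix X Y X' Y' assume X: "X \<in> bounded_rvs M" and Y: "Y \<in> bounded_rvs M" and X': "X' \<in> bounded_rvs M" and Y': "Y' \<in> bounded_rvs M"
    and cop: "copula_of M C X Y" and law: "eq_in_law M X' X" "eq_in_law M Y' Y"
  note b = ISS_basics[OF iss]
  have h: "distortion h" using iss by (simp add: ISS_def)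
  define q where "q = 1 - p"
  have q: "0 < q" "q < 1" using b by (auto simp: q_def)
  have cdf: "rv_cdf V = rv_cdf W" if "V \<in> bounded_rvs M" "W \<in> bounded_rvs M" "eq_in_law M V W" for V W
  proof
    fix x
    have [measurable]: "V \<in> borel_measurable M" "W \<in> borel_measurable M" using that by (auto simp: bounded_rvs_def)
    have "measure (distr M borel V) {..x} = measure (distr M borel W) {..x}"
      using that(3) by (simp add: eq_in_law_def)
    then show "rv_cdf V x = rv_cdf W x"
      by (simp add: rv_cdf_def measure_distr vimage_def Int_def conj_commute)
  qed
  have cX: "rv_cdf X' = rv_cdf X" and cY: "rv_cdf Y' = rv_cdf Y" using cdf X Y X' Y' law by auto
  have sX: "shortfall w X' = shortfall w X" and sY: "shortfall w Y' = shortfall w Y" for w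
    by (simp_all add: shortfall_def cX cY)
  note F = rv_cdf_props(3,4)[OF X] and G = rv_cdf_props(3,4)[OF Y]
  have joint: "\<P>(\<omega> in M. X \<omega> \<le> x \<and> Y \<omega> \<le> y)
      = tail_kernel q (rv_cdf X x) (rv_cdf Y y) + min (min (rv_cdf X x) (rv_cdf Y y)) q" for x y
    using cop F G C_pm_eq_tail_kernel[OF b(1,2)] C by (simp add: copula_of_def rv_cdf_def[symmetric] q_def)
  have tk: "0 \<le> tail_kernel q u v" for u v by (simp add: tail_kernel_def)
  define Z where "Z = (\<lambda>\<omega>. X \<omega> + Y \<omega>)"
  define Z' where "Z' = (\<lambda>\<omega>. X' \<omega> + Y' \<omega>)"
  have Z: "Z \<in> bounded_rvs M" and Z': "Z' \<in> bounded_rvs M"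
    unfolding Z_def Z'_def using bounded_rvs_add X Y X' Y' by auto
  have low: "shortfall w Z' \<le> shortfall w Z" if "0 \<le> w" "w \<le> q" for w
  proof -
    have "shortfall w Z' \<le> shortfall w X + shortfall w Y"
      using shortfall_add_le[OF X' Y', of w] that q by (simp add: Z'_def sX sY)
    also have "\<dots> \<le> shortfall w Z"
      unfolding Z_def
    proof (rule shortfall_add_ge[OF X Y])
      show "min (min (rv_cdf X x) (rv_cdf Y y)) w \<le> \<P>(\<omega> in M. X \<omega> \<le> x \<and> Y \<omega> \<le> y)" for x y
        unfolding joint using tk[of "rv_cdf X x" "rv_cdf Y y"] that by linarith
    qed (use that q in auto)
    finally show ?thesis .
  qed
  have high: "shortfall w Z - shortfall q Z \<le> shortfall w Z' - shortfall q Z'" if wq: "q \<le> w" "w \<le> 1" for w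
  proof -
    \<comment> \<open>The bound for \<open>Z'\<close> holds at some \<open>d\<close> and the one for
      \<open>Z\<close> at every \<open>d\<close>; they meet at the \<open>d\<close> provided
      here.\<close>
    obtain d where "(\<integral>x. tail_kernel q (rv_cdf X x) (rv_cdf Y (d - x)) \<partial>lborel) - (w - q) * d
      \<le> shortfall w Z' - shortfall q Z'"
      using shortfall_diff_ge[OF X' Y' less_imp_le[OF q(1)] wq] unfolding cX cY Z'_def by blast
    then show ?thesis
      using shortfall_diff_le[OF X Y _ _ _ joint, of w d] that q unfolding Z_def by simp
  qed
  have one: "shortfall 1 Z = shortfall 1 Z'"
  proof -
    have "shortfall 1 (\<lambda>\<omega>. V \<omega> + W \<omega>) = shortfall 1 V + shortfall 1 W" if "V \<in> bounded_rvs M" "W \<in> bounded_rvs M" for V W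
      using shortfall_1[OF that(1)] shortfall_1[OF that(2)] shortfall_1[OF bounded_rvs_add[OF that]] by simp
    then show ?thesis using X Y X' Y' by (simp add: Z_def Z'_def sX sY)
  qed
  have J: "(\<integral>x. min (rv_cdf Z x) w - min (rv_cdf Z' x) w \<partial>lborel) = shortfall w Z - shortfall w Z'"
    if "0 \<le> w" "w \<le> 1" for w
  proof -
    have "(\<integral>x. min (rv_cdf Z x) w - min (rv_cdf Z' x) w \<partial>lborel) =
      (\<integral>x. (min (rv_cdf Z x) w - w * indicator {0..} x) - (min (rv_cdf Z' x) w - w * indicator {0..} x) \<partial>lborel)"
      by simp
    also have "\<dots> = shortfall w Z - shortfall w Z'"
      unfolding shortfall_def using integrable_shortfall[OF Z that] integrable_shortfall[OF Z' that]
      by (rule Bochner_Integration.integral_diff)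
    finally show ?thesis .
  qed
  obtain R1 where R1: "0 < R1" "\<And>\<omega>. \<omega> \<in> space M \<Longrightarrow> \<bar>Z \<omega>\<bar> \<le> R1" and m1: "Z \<in> borel_measurable M"
    by (rule bounded_rvsE[OF Z]) auto
  obtain R2 where R2: "0 < R2" "\<And>\<omega>. \<omega> \<in> space M \<Longrightarrow> \<bar>Z' \<omega>\<bar> \<le> R2" and m2: "Z' \<in> borel_measurable M"
    by (rule bounded_rvsE[OF Z']) auto
  have u: "cdf_within (max R1 R2) (rv_cdf Z)" "cdf_within (max R1 R2) (rv_cdf Z')"
    using cdf_within_rv_cdf[OF m1, of "max R1 R2"] cdf_within_rv_cdf[OF m2, of "max R1 R2"] R1(2) R2(2)
    by (meson max.coboundedI1 max.coboundedI2)+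
  obtain c where c: "\<And>x y. 0 \<le> x \<Longrightarrow> x \<le> y \<Longrightarrow> y \<le> p \<Longrightarrow> h y - h x \<le> c * (y - x)"
    "\<And>x y. p \<le> x \<Longrightarrow> x \<le> y \<Longrightarrow> y \<le> 1 \<Longrightarrow> c * (y - x) \<le> h y - h x"
    using ISS_supporting_slope[OF iss] right_deriv_le_iff[OF iss] rd by blast
  \<comment> \<open>Reflection exchanges the convex and the concave part of \<open>h\<close> and
    lets \<open>k\<close> act on distribution functions instead of survival functions.\<close>
  define k where "k t = 1 - h (1 - t)" for t
  have refl: "convex_on {1 - t..1 - s} (\<lambda>x. f (1 - x))" if f: "convex_on {s..t} f" for s t :: real and f :: "real \<Rightarrow> real"
  proof (rule convex_onI)
    fix l x y :: real assume "0 < l" "l < 1" "x \<in> {1 - t..1 - s}" "y \<in> {1 - t..1 - s}"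
    moreover have "1 - ((1 - l) *\<^sub>R x + l *\<^sub>R y) = (1 - l) *\<^sub>R (1 - x) + l *\<^sub>R (1 - y)" by (simp add: algebra_simps)
    ultimately show "f (1 - ((1 - l) *\<^sub>R x + l *\<^sub>R y)) \<le> (1 - l) * f (1 - x) + l * f (1 - y)"
      using convex_onD[OF f, of l "1 - x" "1 - y"] by simp
  qed simp
  have shift: "convex_on S (\<lambda>x. f x + e)" if "convex_on S f" for S :: "real set" and f and e :: real
    using that convex_on_const[of S e] convex_on_imp_convex by (intro convex_on_add) auto
  have "0 \<le> (\<integral>x. k (rv_cdf Z x) - k (rv_cdf Z' x) \<partial>lborel)"
  proof (rule integral_diff_cdf_nonneg[OF u q])
    show "mono_on {0..1} k" using b(5) by (auto simp: mono_on_def k_def)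
    have "continuous_on {0..1} h" using iss by (simp add: ISS_def)
    then have "continuous_on {0..1} (\<lambda>t. h (1 - t))"
      by (rule continuous_on_compose2) (auto intro!: continuous_intros)
    then show "continuous_on {0..1} k" unfolding k_def by (intro continuous_intros)
    show "concave_on {0..q} k"
      using shift[OF refl[OF ISS_convex(1)[OF iss]], of "-1"] by (simp add: concave_on_def k_def q_def)
    show "convex_on {q..1} k"
      using shift[OF refl[OF ISS_convex(2)[OF iss]], of 1] by (simp add: k_def[abs_def] q_def)
    show "c * (y - x) \<le> k y - k x" if "0 \<le> x" "x \<le> y" "y \<le> q" for x y
      using c(2)[of "1 - y" "1 - x"] that by (simp add: k_def q_def)
    show "k y - k x \<le> c * (y - x)" if "q \<le> x" "x \<le> y" "y \<le> 1" for x y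
      using c(1)[of "1 - y" "1 - x"] that by (simp add: k_def q_def)
    show "0 \<le> (\<integral>x. min (rv_cdf Z x) w - min (rv_cdf Z' x) w \<partial>lborel)" if "w \<in> {0..q}" for w
      using low[of w] J[of w] that q by simp
    show "(\<integral>x. min (rv_cdf Z x) w - min (rv_cdf Z' x) w \<partial>lborel)
        \<le> (\<integral>x. min (rv_cdf Z x) q - min (rv_cdf Z' x) q \<partial>lborel)" if "w \<in> {q..1}" for w
      using high[of w] J[of w] J[of q] that q by simp
    have "min (rv_cdf Z x) 1 = rv_cdf Z x" "min (rv_cdf Z' x) 1 = rv_cdf Z' x" for x
      using rv_cdf_props(4)[OF Z] rv_cdf_props(4)[OF Z'] by (simp_all add: min_absorb1)
    then show "(\<integral>x. rv_cdf Z x - rv_cdf Z' x \<partial>lborel) = 0"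
      using J[of 1] one by simp
  qed
  then show "distorted_expectation M h (\<lambda>\<omega>. X \<omega> + Y \<omega>) \<le> distorted_expectation M h (\<lambda>\<omega>. X' \<omega> + Y' \<omega>)"
    using distorted_expectation_diff[OF h Z Z'] by (simp add: k_def Z_def Z'_def)
qed

end

theorem theorem4:
  fixes M :: "'a measure" and h :: "real \<Rightarrow> real" and p :: real
    and C :: "real \<Rightarrow> real \<Rightarrow> real"
  assumes "prob_space M" and "atomless M"
    and "ISS h p" and "copula C"
  shows "((\<forall>u\<in>{0..1}. \<forall>v\<in>{0..1}. C u v = C_pm p u v) \<and> right_deriv h p \<ge> right_deriv h 0
            \<longrightarrow> universally_optimal M h C) \<and>
         (strictly_ISS h p \<longrightarrow>
            ((\<forall>u\<in>{0..1}. \<forall>v\<in>{0..1}. C u v = C_pm p u v) \<and> right_deriv h p \<ge> right_deriv h 0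
              \<longleftrightarrow> universally_optimal M h C))"
proof -
  interpret prob_space M by fact
  have forward: "universally_optimal M h C"
    if "\<forall>u\<in>{0..1}. \<forall>v\<in>{0..1}. C u v = C_pm p u v" "right_deriv h p \<ge> right_deriv h 0"
    using that C_pm_imp_universally_optimal[OF \<open>ISS h p\<close>] by blast
  have backward: "(\<forall>u\<in>{0..1}. \<forall>v\<in>{0..1}. C u v = C_pm p u v) \<and> right_deriv h p \<ge> right_deriv h 0"
    if si: "strictly_ISS h p" and opt: "universally_optimal M h C"
    using universally_optimal_imp_C_pm[OF assms(2,4) si opt]
      universally_optimal_imp_slope_le[OF assms(2,4) si opt] right_deriv_le_iff[OF assms(3)] by blast
  show ?thesis using forward backward by blast
qed

end
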